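(* Let $p\in\mathbb{N}$, $j=\begin{bmatrix} I_p&0\\0&-I_p\end{bmatrix}$, and let $\mathcal{I}$ be either a finite interval $[0,T]$ ($0<T<\infty$) or the semi-axis $[0,\infty)$. Let $\beta$ be a $p\times 2p$ matrix function on $\mathcal{I}$ which is two times differentiable and such that $\beta''\in L_2^{p\times 2p}(0,T)$ if $\mathcal{I}=[0,T]$, or such that the entries of $\beta''$ are locally square-integrable if $\mathcal{I}=[0,\infty)$. Assume that $$\beta(x)j\beta(x)^*=0,\qquad \beta'(x)j\beta(x)^*=\mathrm{i}I_p\qquad (x\in\mathcal{I}),$$ and put $H(x)=\beta(x)^*\beta(x)$. Let $W(x,\lambda)$ be the $2p\times 2p$ fundamental solution of the canonical system $$w'(x,\lambda)=\mathrm{i}\lambda jH(x)w(x,\lambda)\qquad (x\in\mathcal{I})$$ normalized by $W(0,\lambda)=I_{2p}$. Then $W$ admits the representation $$W(\ell,\lambda)=w_A\Big(\ell,\frac1\lambda\Big)$$ for $\lambda\in\mathbb{C}\setminus\{0\}$ and all $\ell>0$ in $\mathcal{I}$, where $w_A(\ell,\lambda)$ is the transfer matrix function associated with $\beta$ which is defined in the context.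
   Context: Notation: $'$ is $d/dx$; $M^*$ is the conjugate transpose of a matrix or the adjoint of an operator; $L_2^p(0,b)$ is the space of square-integrable $\mathbb{C}^p$-valued functions on $(0,b)$; $L_2^{p\times q}(0,b)$ is the class of $p\times q$ matrix functions with entries in $L_2(0,b)$. Definition of $w_A(\ell,\lambda)$. For $0<T<\infty$ (in the semi-axis case, choose any finite $T\ge \ell$), define the operators in $L_2^p(0,T)$ $$Kf=\mathrm{i}\beta(x)j\int_0^x\beta(t)^*f(t)\,dt,\qquad Af=\int_0^x(t-x)f(t)\,dt .$$ Under the stated assumptions on $\beta$ there is a bounded, boundedly invertible operator $V$ in $L_2^p(0,T)$ of the form $$(Vf)(x)=u(x)\Big(f(x)+\int_0^x\mathcal{V}(x,t)f(t)\,dt\Big),$$ where $u$ is a unitary-valued absolutely continuous $p\times p$ matrix function on $[0,T]$ and $\sup_{0\le t\le x\le T}\|\mathcal{V}(x,t)\|<\infty$, such that $K=VAV^{-1}$. Fix such a $V$ and set $$S=V^{-1}(V^* )^{-1},\qquad \Pi(x)=(V^{-1}\beta)(x)\ \ (V^{-1}\text{ applied to }\beta\text{ columnwise}),$$ and let $\Pi:\mathbb{C}^{2p}\to L_2^p(0,T)$ be the operator $(\Pi h)(x)=\Pi(x)h$. For $0<\ell\le T$ let $P_\ell:L_2^p(0,T)\to L_2^p(0,\ell)$ be the restriction $(P_\ell f)(x)=f(x)$, $0<x<\ell$, and let $$S_\ell=P_\ell SP_\ell^*,\qquad A_\ell=P_\ell AP_\ell^*,\qquad \Pi_\ell=P_\ell\Pi,$$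 $$w_A(\ell,\lambda)=I_{2p}-\mathrm{i}j\Pi_\ell^*S_\ell^{-1}(A_\ell-\lambda I)^{-1}\Pi_\ell\qquad(\lambda\ne0).$$ The function $w_A(\ell,\lambda)$ does not depend on the values of $\beta$ on $(\ell,T]$ nor on the choice of $T\ge\ell$, so that in the case $\mathcal{I}=[0,\infty)$ it is well defined for all $0<\ell<\infty$. *)

theory Defs
  imports "HOL-Analysis.Analysis"
begin

section \<open>Matrices\<close>

text \<open>The index type \<open>'p + 'p\<close> indexes \<open>\<complex>\<^sup>2\<^sup>p\<close>, where \<open>p = CARD('p) \<ge> 1\<close>. The scalar
  multiple \<open>c M\<close> of a matrix is written \<open>mat c ** M\<close>.\<close>

definition ctranspose :: "complex^'n^'m \<Rightarrow> complex^'m^'n"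
  where "ctranspose M = (\<chi> a b. cnj (M $ b $ a))"

definition jmat :: "complex^('p::finite + 'p)^('p + 'p)"
  where "jmat = (\<chi> a b. if a = b then (case a of Inl _ \<Rightarrow> 1 | Inr _ \<Rightarrow> -1) else 0)"

definition unitary_matrix :: "complex^'n::finite^'n \<Rightarrow> bool"
  where "unitary_matrix M \<longleftrightarrow> ctranspose M ** M = mat 1 \<and> M ** ctranspose M = mat 1"


section \<open>Absolute continuity\<close>

text \<open>The members of a division are non-overlapping compact intervals \<open>k = {Inf k..Sup k}\<close>.\<close>

definition absolutely_continuous_function_on :: "real \<Rightarrow> real \<Rightarrow> (real \<Rightarrow> 'a::real_normed_vector) \<Rightarrow> bool"
  where "absolutely_continuous_function_on a b f \<longleftrightarrow>
    (\<forall>\<epsilon>>0. \<exists>\<delta>>0. \<forall>D X. D division_of X \<longrightarrow> X \<subseteq> {a..b} \<longrightarrow> (\<Sum>k\<in>D. Sup k - Inf k) < \<delta> \<longrightarrow>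
       (\<Sum>k\<in>D. norm (f (Sup k) - f (Inf k))) < \<epsilon>)"


section \<open>Square-integrable functions and operators between the spaces L2\<close>

text \<open>Elements of \<open>L\<^sub>2(0,b)\<close> are represented by functions on \<open>\<real>\<close>, of which only the values on
  \<open>(0,b)\<close> matter; equality in \<open>L\<^sub>2(0,b)\<close> is \<open>L2_eq b\<close>. Accordingly, operators are maps on
  representatives, and adjoints and inverses, being determined only up to \<open>L2_eq\<close>, are picked by
  Hilbert choice.\<close>

abbreviation leb :: "real \<Rightarrow> real measure"
  where "leb b \<equiv> lebesgue_on {0<..<b}"

definition L2 :: "real \<Rightarrow> (real \<Rightarrow> 'a::euclidean_space) set"
  where "L2 b = {f. f \<in> borel_measurable (leb b) \<and> integrable (leb b) (\<lambda>x. (norm (f x))\<^sup>2)}"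

definition L2_eq :: "real \<Rightarrow> (real \<Rightarrow> 'a::euclidean_space) \<Rightarrow> (real \<Rightarrow> 'a) \<Rightarrow> bool"
  where "L2_eq b f g \<longleftrightarrow> (AE x in leb b. f x = g x)"

definition L2_norm :: "real \<Rightarrow> (real \<Rightarrow> 'a::euclidean_space) \<Rightarrow> real"
  where "L2_norm b f = sqrt (\<integral>x. (norm (f x))\<^sup>2 \<partial>leb b)"

definition cinner :: "complex^'n::finite \<Rightarrow> complex^'n \<Rightarrow> complex"
  where "cinner v w = (\<Sum>i\<in>UNIV. v $ i * cnj (w $ i))"

definition L2_inner :: "real \<Rightarrow> (real \<Rightarrow> complex^'n::finite) \<Rightarrow> (real \<Rightarrow> complex^'n) \<Rightarrow> complex"
  where "L2_inner b f g = (\<integral>x. cinner (f x) (g x) \<partial>leb b)"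

definition L2_bounded_op ::
    "real \<Rightarrow> real \<Rightarrow> ((real \<Rightarrow> complex^'n::finite) \<Rightarrow> (real \<Rightarrow> complex^'m::finite)) \<Rightarrow> bool"
  where "L2_bounded_op a b F \<longleftrightarrow>
    (\<forall>f\<in>L2 a. F f \<in> L2 b) \<and>
    (\<forall>f\<in>L2 a. \<forall>g\<in>L2 a. \<forall>c d. L2_eq b (F (\<lambda>x. c *s f x + d *s g x)) (\<lambda>x. c *s F f x + d *s F g x)) \<and>
    (\<exists>C. \<forall>f\<in>L2 a. L2_norm b (F f) \<le> C * L2_norm a f)"

definition L2_bounded_inverse ::
    "real \<Rightarrow> ((real \<Rightarrow> complex^'n::finite) \<Rightarrow> (real \<Rightarrow> complex^'n)) \<Rightarrow>
      ((real \<Rightarrow> complex^'n) \<Rightarrow> (real \<Rightarrow> complex^'n)) \<Rightarrow> bool"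
  where "L2_bounded_inverse b F G \<longleftrightarrow>
    L2_bounded_op b b G \<and> (\<forall>f\<in>L2 b. L2_eq b (G (F f)) f \<and> L2_eq b (F (G f)) f)"

definition L2_inv ::
    "real \<Rightarrow> ((real \<Rightarrow> complex^'n::finite) \<Rightarrow> (real \<Rightarrow> complex^'n)) \<Rightarrow>
      (real \<Rightarrow> complex^'n) \<Rightarrow> (real \<Rightarrow> complex^'n)"
  where "L2_inv b F = (SOME G. L2_bounded_inverse b F G)"

text \<open>The adjoint of \<open>F : X \<rightarrow> Y\<close>, where \<open>X\<close> and \<open>Y\<close> carry the inner products \<open>ipX\<close> and \<open>ipY\<close>.\<close>

definition adj_op ::
    "'a set \<Rightarrow> ('a \<Rightarrow> 'a \<Rightarrow> complex) \<Rightarrow> 'b set \<Rightarrow> ('b \<Rightarrow> 'b \<Rightarrow> complex) \<Rightarrow> ('a \<Rightarrow> 'b) \<Rightarrow> 'b \<Rightarrow> 'a"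
  where "adj_op X ipX Y ipY F =
    (SOME G. \<forall>y\<in>Y. G y \<in> X \<and> (\<forall>x\<in>X. ipY (F x) y = ipX x (G y)))"

definition L2_adj ::
    "real \<Rightarrow> real \<Rightarrow> ((real \<Rightarrow> complex^'n::finite) \<Rightarrow> (real \<Rightarrow> complex^'m::finite)) \<Rightarrow>
      (real \<Rightarrow> complex^'m) \<Rightarrow> (real \<Rightarrow> complex^'n)"
  where "L2_adj a b = adj_op (L2 a) (L2_inner a) (L2 b) (L2_inner b)"

definition vec_L2_adj ::
    "real \<Rightarrow> (complex^'n::finite \<Rightarrow> (real \<Rightarrow> complex^'m::finite)) \<Rightarrow> (real \<Rightarrow> complex^'m) \<Rightarrow> complex^'n"
  where "vec_L2_adj b = adj_op UNIV cinner (L2 b) (L2_inner b)"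


section \<open>The transfer matrix function\<close>

definition K_op ::
    "(real \<Rightarrow> complex^('p::finite + 'p)^'p) \<Rightarrow> (real \<Rightarrow> complex^'p) \<Rightarrow> (real \<Rightarrow> complex^'p)"
  where "K_op \<beta> f = (\<lambda>x. (mat \<i> ** \<beta> x ** jmat) *v (\<integral>t. ctranspose (\<beta> t) *v f t \<partial>leb x))"

definition A_op :: "(real \<Rightarrow> complex^'p::finite) \<Rightarrow> (real \<Rightarrow> complex^'p)"
  where "A_op f = (\<lambda>x. \<integral>t. (t - x) *\<^sub>R f t \<partial>leb x)"

text \<open>All norms on matrices being equivalent, the bound on the kernel is stated with the library norm.\<close>

definition triangular_form :: "real \<Rightarrow> ((real \<Rightarrow> complex^'p::finite) \<Rightarrow> (real \<Rightarrow> complex^'p)) \<Rightarrow> bool"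
  where "triangular_form T V \<longleftrightarrow>
    (\<exists>(u :: real \<Rightarrow> complex^'p^'p) (v :: real \<Rightarrow> real \<Rightarrow> complex^'p^'p).
      (\<forall>x\<in>{0..T}. unitary_matrix (u x)) \<and>
      absolutely_continuous_function_on 0 T u \<and>
      (\<lambda>(x, t). v x t) \<in> borel_measurable (lebesgue_on {(x, t). 0 \<le> t \<and> t \<le> x \<and> x \<le> T}) \<and>
      bdd_above {norm (v x t) | x t. 0 \<le> t \<and> t \<le> x \<and> x \<le> T} \<and>
      (\<forall>f\<in>L2 T. L2_eq T (V f) (\<lambda>x. u x *v (f x + (\<integral>t. v x t *v f t \<partial>leb x)))))"

definition similarity_op ::
    "real \<Rightarrow> (real \<Rightarrow> complex^('p::finite + 'p)^'p) \<Rightarrow>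
      ((real \<Rightarrow> complex^'p) \<Rightarrow> (real \<Rightarrow> complex^'p)) \<Rightarrow> bool"
  where "similarity_op T \<beta> V \<longleftrightarrow>
    L2_bounded_op T T V \<and> (\<exists>G. L2_bounded_inverse T V G) \<and> triangular_form T V \<and>
    (\<forall>f\<in>L2 T. L2_eq T (K_op \<beta> f) (V (A_op (L2_inv T V f))))"

definition S_op ::
    "real \<Rightarrow> ((real \<Rightarrow> complex^'p::finite) \<Rightarrow> (real \<Rightarrow> complex^'p)) \<Rightarrow>
      (real \<Rightarrow> complex^'p) \<Rightarrow> (real \<Rightarrow> complex^'p)"
  where "S_op T V = L2_inv T V \<circ> L2_inv T (L2_adj T T V)"

definition Pi_fun ::
    "real \<Rightarrow> ((real \<Rightarrow> complex^'p::finite) \<Rightarrow> (real \<Rightarrow> complex^'p)) \<Rightarrow>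
      (real \<Rightarrow> complex^('p + 'p)^'p) \<Rightarrow> real \<Rightarrow> complex^('p + 'p)^'p"
  where "Pi_fun T V \<beta> x = (\<chi> i k. L2_inv T V (\<lambda>t. column k (\<beta> t)) x $ i)"

definition Pi_op ::
    "real \<Rightarrow> ((real \<Rightarrow> complex^'p::finite) \<Rightarrow> (real \<Rightarrow> complex^'p)) \<Rightarrow>
      (real \<Rightarrow> complex^('p + 'p)^'p) \<Rightarrow> complex^('p + 'p) \<Rightarrow> real \<Rightarrow> complex^'p"
  where "Pi_op T V \<beta> h = (\<lambda>x. Pi_fun T V \<beta> x *v h)"

text \<open>The restriction \<open>L\<^sub>2(0,T) \<rightarrow> L\<^sub>2(0,l)\<close>; the values off \<open>(0,l)\<close> are irrelevant.\<close>

definition P_op :: "real \<Rightarrow> (real \<Rightarrow> complex^'p::finite) \<Rightarrow> (real \<Rightarrow> complex^'p)"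
  where "P_op l f = (\<lambda>x. if x \<in> {0<..<l} then f x else 0)"

definition compress ::
    "real \<Rightarrow> real \<Rightarrow> ((real \<Rightarrow> complex^'p::finite) \<Rightarrow> (real \<Rightarrow> complex^'p)) \<Rightarrow>
      (real \<Rightarrow> complex^'p) \<Rightarrow> (real \<Rightarrow> complex^'p)"
  where "compress T l F = P_op l \<circ> F \<circ> L2_adj T l (P_op l)"

text \<open>\<open>matrix\<close> turns the operator \<open>\<Pi>\<^sub>l\<^sup>* S\<^sub>l\<^sup>-\<^sup>1 (A\<^sub>l - zI)\<^sup>-\<^sup>1 \<Pi>\<^sub>l\<close> on \<open>\<complex>\<^sup>2\<^sup>p\<close> into its matrix.\<close>

definition w_A ::
    "real \<Rightarrow> ((real \<Rightarrow> complex^'p::finite) \<Rightarrow> (real \<Rightarrow> complex^'p)) \<Rightarrow>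
      (real \<Rightarrow> complex^('p + 'p)^'p) \<Rightarrow> real \<Rightarrow> complex \<Rightarrow> complex^('p + 'p)^('p + 'p)"
  where "w_A T V \<beta> l z =
    (let Sl = compress T l (S_op T V);
         Al = compress T l A_op;
         Pl = P_op l \<circ> Pi_op T V \<beta>
     in mat 1 - mat \<i> ** jmat **
          matrix (vec_L2_adj l Pl \<circ> L2_inv l Sl \<circ> L2_inv l (\<lambda>f x. Al f x - z *s f x) \<circ> Pl))"


section \<open>The canonical system\<close>

definition Hamiltonian :: "(real \<Rightarrow> complex^('p::finite + 'p)^'p) \<Rightarrow> real \<Rightarrow> complex^('p + 'p)^('p + 'p)"
  where "Hamiltonian \<beta> x = ctranspose (\<beta> x) ** \<beta> x"

definition fundamental_solution ::
    "real set \<Rightarrow> (real \<Rightarrow> complex^('p::finite + 'p)^('p + 'p)) \<Rightarrow>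
      (real \<Rightarrow> complex \<Rightarrow> complex^('p + 'p)^('p + 'p)) \<Rightarrow> bool"
  where "fundamental_solution I H W \<longleftrightarrow>
    (\<forall>z. W 0 z = mat 1 \<and>
      (\<forall>x\<in>I. ((\<lambda>x. W x z) has_vector_derivative mat (\<i> * z) ** jmat ** H x ** W x z) (at x within I)))"

end

theory Submission
  imports Defs
begin

text \<open>
  Write \<open>V\<^sub>l\<close>, \<open>K\<^sub>l\<close>, \<open>A\<^sub>l\<close> for the operators \<open>V\<close>, \<open>K\<close>, \<open>A\<close> acting on \<open>(0,l)\<close>, and \<open>B\<close> for
  multiplication by \<open>\<beta>\<close>, a map from \<open>\<complex>\<^sup>2\<^sup>p\<close> to functions. All three operators are lower triangular:
  the values of \<open>V f\<close> on \<open>(0,l)\<close> depend only on those of \<open>f\<close>. Dually, \<open>V\<^sup>*\<close> maps functions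
  supported in \<open>(0,l)\<close> to functions supported there. Truncating \<open>S = V\<^sup>-\<^sup>1 (V\<^sup>*)\<^sup>-\<^sup>1\<close> therefore amounts to
  truncating each factor, so that the inverse of \<open>S\<^sub>l\<close> is \<open>V\<^sub>l\<^sup>* V\<^sub>l\<close> (\<open>Sl_inverse\<close>). Together with
  \<open>V\<^sub>l \<Pi>\<^sub>l = B\<close> and \<open>V\<^sub>l A\<^sub>l = K\<^sub>l V\<^sub>l\<close> this removes \<open>V\<close> from the transfer function:
  \<open>w\<^sub>A(l, c) = 1 - \<i> j \<Pi>\<^sub>l\<^sup>* V\<^sub>l\<^sup>* V\<^sub>l (A\<^sub>l - c)\<^sup>-\<^sup>1 \<Pi>\<^sub>l = 1 - \<i> j B\<^sup>* (K\<^sub>l - c)\<^sup>-\<^sup>1 B\<close>.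

  On the other side, the canonical system in integrated form reads
  \<open>W(x) = 1 + \<i> z j \<integral>\<beta>\<^sup>* \<beta> W\<close>, the integral being over \<open>(0,x)\<close>. Multiplied by \<open>\<beta>(x)\<close> from the left
  it becomes \<open>(1 - z K) (\<beta> W) = \<beta>\<close>, that is, \<open>(K\<^sub>l - 1/z)\<^sup>-\<^sup>1 \<beta> = - z \<beta> W\<close>. Inserting this for \<open>c = 1/z\<close> gives
  \<open>w\<^sub>A(l, 1/z) = 1 + \<i> z j \<integral>\<beta>\<^sup>* \<beta> W\<close> over \<open>(0,l)\<close>, which is \<open>W(l)\<close> by the integrated system again.

  The analytic content is that all the inverses and adjoints involved exist; otherwise the Hilbert
  choices in the definitions would be arbitrary. One fact provides all the inverses: \<open>1 + N\<close> is boundedly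
  invertible for every Volterra operator \<open>N\<close> with a bounded measurable kernel (\<open>volterra.invertible\<close>), by a
  Neumann series with factorially decaying terms. It applies to \<open>V\<^sub>l\<close>, to its adjoint, to \<open>A\<^sub>l - c\<close> and to
  \<open>1 - z K\<^sub>l\<close>. The adjoint of a Volterra operator is obtained from Fubini's theorem (\<open>int_op_adjoint\<close>), once
  the Lebesgue measurable kernel of \<open>V\<close> has been replaced by a Borel measurable one
  (\<open>triangular_form_kernel\<close>).
\<close>

section \<open>Matrices and the complex inner product\<close>

lemma bounded_bilinear_mv: "bounded_bilinear ((*v) :: complex^'n::finite^'m::finite \<Rightarrow> _)"
  unfolding bilinear_conv_bounded_bilinear[symmetric] bilinear_def
  by (auto intro!: linearI simp: matrix_vector_mult_def vec_eq_iff sum.distrib algebra_simps scaleR_sum_right)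

lemma bounded_bilinear_mm:
  "bounded_bilinear ((**) :: complex^'n::finite^'m::finite \<Rightarrow> complex^'k::finite^'n \<Rightarrow> _)"
  unfolding bilinear_conv_bounded_bilinear[symmetric] bilinear_def
  by (auto intro!: linearI simp: matrix_matrix_mult_def vec_eq_iff sum.distrib algebra_simps scaleR_sum_right)

lemma bounded_bilinear_cinner: "bounded_bilinear (cinner :: complex^'n::finite \<Rightarrow> _)"
  unfolding bilinear_conv_bounded_bilinear[symmetric] bilinear_def
  by (auto intro!: linearI simp: cinner_def sum.distrib algebra_simps scaleR_sum_right)

lemma bounded_linear_ctranspose: "bounded_linear (ctranspose :: complex^'n::finite^'m::finite \<Rightarrow> _)"
  unfolding linear_conv_bounded_linear[symmetric]
  by (auto intro!: linearI simp: ctranspose_def vec_eq_iff)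

lemma bounded_linear_vscale: "bounded_linear (\<lambda>x :: complex^'n::finite. c *s x)"
  unfolding linear_conv_bounded_linear[symmetric]
  by (auto intro!: linearI simp: vec_eq_iff algebra_simps)

lemma norm_vscale: "norm (c *s (x :: complex^'n::finite)) = norm c * norm x"
  by (simp add: norm_vec_def norm_mult L2_set_right_distrib)

lemma norm_sum_mult_le: "norm (\<Sum>i\<in>UNIV. (x :: complex^'n::finite) $ i * y $ i) \<le> norm x * norm y"
proof -
  have "norm (\<Sum>i\<in>UNIV. x $ i * y $ i) \<le> (\<Sum>i\<in>UNIV. norm (x $ i * y $ i))" by (rule norm_sum)
  also have "\<dots> \<le> norm x * norm y"
    unfolding norm_vec_def using L2_set_mult_ineq[of "\<lambda>i. norm (x $ i)" "\<lambda>i. norm (y $ i)" UNIV]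
    by (simp add: norm_mult)
  finally show ?thesis .
qed

text \<open>The library norm of a matrix is the Frobenius norm, which dominates the operator norm by Cauchy-Schwarz in
  each row.\<close>

lemma norm_mv: "norm ((M :: complex^'n::finite^'m::finite) *v y) \<le> norm M * norm y"
proof -
  have "norm (M *v y) = L2_set (\<lambda>i. norm (\<Sum>j\<in>UNIV. M $ i $ j * y $ j)) UNIV"
    by (simp add: norm_vec_def[of "M *v y"]) (simp add: matrix_vector_mult_def)
  also have "\<dots> \<le> L2_set (\<lambda>i. norm (M $ i) * norm y) UNIV"
    by (intro L2_set_mono norm_sum_mult_le) auto
  also have "\<dots> = norm M * norm y"
    by (simp add: norm_vec_def[of M] L2_set_left_distrib)
  finally show ?thesis .
qed

lemma norm_ctranspose: "norm (ctranspose (M :: complex^'n::finite^'m::finite)) = norm M"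
  unfolding norm_vec_def ctranspose_def L2_set_def
  by (auto intro!: sum.swap simp: sum_nonneg)

lemma norm_cinner_le: "norm (cinner v w) \<le> norm v * norm w"
proof -
  have "norm (cinner v w) \<le> norm v * norm (\<chi> i. cnj (w $ i))"
    using norm_sum_mult_le[of v "\<chi> i. cnj (w $ i)"] by (simp add: cinner_def)
  also have "norm (\<chi> i. cnj (w $ i)) = norm w" by (simp add: norm_vec_def)
  finally show ?thesis .
qed

lemma cinner_self: "cinner v v = of_real ((norm v)\<^sup>2)"
  by (simp add: cinner_def norm_vec_def L2_set_def sum_nonneg complex_norm_square[symmetric] del: of_real_sum) (simp add: complex_norm_square)

lemma cinner_mv: "cinner (M *v x) y = cinner x (ctranspose M *v y)"
  unfolding cinner_def matrix_vector_mult_def ctranspose_def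
  by (simp add: sum_distrib_right sum_distrib_left cnj_sum mult_ac) (rule sum.swap)

lemma cinner_commute: "cinner w v = cnj (cinner v w)"
  by (simp add: cinner_def cnj_sum mult.commute)

lemma unitary_mv_cancel:
  assumes "unitary_matrix (u :: complex^'n::finite^'n)"
  shows "ctranspose u *v (u *v x) = x" "u *v (ctranspose u *v x) = x"
  using assms by (auto simp: unitary_matrix_def matrix_vector_mul_assoc)

lemma norm_unitary_mv:
  assumes "unitary_matrix (u :: complex^'n::finite^'n)"
  shows "norm (u *v x) = norm x" "norm (ctranspose u *v x) = norm x"
proof -
  have "complex_of_real ((norm (u *v x))\<^sup>2) = of_real ((norm x)\<^sup>2)" for x
    unfolding cinner_self[symmetric] cinner_mv using unitary_mv_cancel[OF assms] by simp
  then have *: "norm (u *v x) = norm x" for x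
    by (simp only: of_real_eq_iff) simp
  show "norm (u *v x) = norm x" by (rule *)
  show "norm (ctranspose u *v x) = norm x"
    using *[of "ctranspose u *v x"] unitary_mv_cancel[OF assms] by simp
qed

section \<open>Square-integrable functions\<close>

lemma finite_measure_leb: "finite_measure (leb b)"
  by (rule finite_measureI) (cases "0 \<le> b", auto simp: emeasure_restrict_space)

lemma measurable_leb_borel: "f \<in> borel_measurable borel \<Longrightarrow> f \<in> borel_measurable (leb b)"
  by (simp add: measurable_completion measurable_restrict_space1)

text \<open>All integral operators and resolvents below satisfy a pointwise bound of this shape: the function itself is
  only square-integrable, but what is added to it is bounded.\<close>

lemma L2_dominated:
  fixes f :: "real \<Rightarrow> 'a::euclidean_space"
  assumes "f \<in> borel_measurable (leb b)" and "AE x in leb b. norm (f x) \<le> norm (g x) + (D::real)"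
    and "(g :: real \<Rightarrow> 'b::euclidean_space) \<in> L2 b"
  shows "f \<in> L2 b"
proof -
  interpret finite_measure "leb b" by (rule finite_measure_leb)
  have "integrable (leb b) (\<lambda>x. (norm (f x))\<^sup>2)"
  proof (rule Bochner_Integration.integrable_bound)
    show "integrable (leb b) (\<lambda>x. 2 * (norm (g x))\<^sup>2 + 2 * D\<^sup>2)" using assms(3) by (auto simp: L2_def)
    show "(\<lambda>x. (norm (f x))\<^sup>2) \<in> borel_measurable (leb b)" using assms(1) by measurable
    show "AE x in leb b. norm ((norm (f x))\<^sup>2) \<le> norm (2 * (norm (g x))\<^sup>2 + 2 * D\<^sup>2)"
      using assms(2)
    proof eventually_elim
      case (elim x)
      have "(norm (f x))\<^sup>2 \<le> (norm (g x) + D)\<^sup>2" using elim by (intro power_mono) auto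
      also have "\<dots> \<le> 2 * (norm (g x))\<^sup>2 + 2 * D\<^sup>2"
        using sum_squares_ge_zero[of "norm (g x) - D" 0] by (simp add: power2_eq_square algebra_simps)
      finally show ?case by simp
    qed
  qed
  then show ?thesis using assms(1) by (simp add: L2_def)
qed

lemma L2_zero: "(\<lambda>x. 0) \<in> L2 b"
  by (simp add: L2_def)

lemma L2_bounded:
  assumes "f \<in> borel_measurable (leb b)" "\<And>x. x \<in> {0<..<b} \<Longrightarrow> norm (f x) \<le> D"
  shows "f \<in> L2 b"
  by (rule L2_dominated[OF assms(1) _ L2_zero, of D]) (auto simp: AE_restrict_space_iff assms(2))

lemma L2_measurable: "f \<in> L2 b \<Longrightarrow> f \<in> borel_measurable (leb b)"
  by (simp add: L2_def)

lemma L2_sq_integrable: "f \<in> L2 b \<Longrightarrow> integrable (leb b) (\<lambda>x. (norm (f x))\<^sup>2)"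
  by (simp add: L2_def)

lemma L2_add: "f \<in> L2 b \<Longrightarrow> g \<in> L2 b \<Longrightarrow> (\<lambda>x. f x + g x) \<in> L2 b"
proof (rule L2_dominated[of _ b "\<lambda>x. norm (f x) + norm (g x)" 0])
  assume fg: "f \<in> L2 b" "g \<in> L2 b"
  have [measurable]: "f \<in> borel_measurable (leb b)" "g \<in> borel_measurable (leb b)"
    using fg by (auto simp: L2_def)
  show "(\<lambda>x. f x + g x) \<in> borel_measurable (leb b)" by measurable
  show "AE x in leb b. norm (f x + g x) \<le> norm (norm (f x) + norm (g x)) + 0"
    by (auto simp: norm_triangle_ineq)
  have "integrable (leb b) (\<lambda>x. (norm (norm (f x) + norm (g x)))\<^sup>2)"
  proof (rule Bochner_Integration.integrable_bound)
    show "integrable (leb b) (\<lambda>x. 2 * (norm (f x))\<^sup>2 + 2 * (norm (g x))\<^sup>2)" using fg by (auto simp: L2_def)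
    show "AE x in leb b. norm ((norm (norm (f x) + norm (g x)))\<^sup>2) \<le> norm (2 * (norm (f x))\<^sup>2 + 2 * (norm (g x))\<^sup>2)"
    proof (rule AE_I2)
      fix x
      have "(norm (f x) + norm (g x))\<^sup>2 \<le> 2 * (norm (f x))\<^sup>2 + 2 * (norm (g x))\<^sup>2"
        using sum_squares_ge_zero[of "norm (f x) - norm (g x)" 0] by (simp add: power2_eq_square algebra_simps)
      then show "norm ((norm (norm (f x) + norm (g x)))\<^sup>2) \<le> norm (2 * (norm (f x))\<^sup>2 + 2 * (norm (g x))\<^sup>2)"
        by simp
    qed
  qed measurable
  then show "(\<lambda>x. norm (f x) + norm (g x)) \<in> L2 b" unfolding L2_def by auto
qed

lemma L2_scale:
  assumes f: "f \<in> L2 b" shows "(\<lambda>x. c *s (f x :: complex^'n::finite)) \<in> L2 b"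
proof -
  have "(\<lambda>x. c *s f x) \<in> borel_measurable (leb b)"
    using measurable_compose[OF L2_measurable[OF f] borel_measurable_continuous_onI[OF
      linear_continuous_on[OF bounded_linear_vscale]]] .
  then show ?thesis using f by (simp add: L2_def norm_vscale power_mult_distrib)
qed

lemma L2_lin: "f \<in> L2 b \<Longrightarrow> g \<in> L2 b \<Longrightarrow> (\<lambda>x. c *s f x + d *s (g x :: complex^'n::finite)) \<in> L2 b"
  by (intro L2_add L2_scale)

lemma L2_diff: "f \<in> L2 b \<Longrightarrow> g \<in> L2 b \<Longrightarrow> (\<lambda>x. f x - (g x :: complex^'n::finite)) \<in> L2 b"
  using L2_lin[of f b g 1 "-1"] by simp

lemma L2_integrable: "f \<in> L2 b \<Longrightarrow> integrable (leb b) f"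
proof -
  assume f: "f \<in> L2 b"
  interpret finite_measure "leb b" by (rule finite_measure_leb)
  show ?thesis
  proof (rule Bochner_Integration.integrable_bound)
    show "integrable (leb b) (\<lambda>x. 1 + (norm (f x))\<^sup>2)" using f by (auto simp: L2_def)
    show "AE x in leb b. norm (f x) \<le> norm (1 + (norm (f x))\<^sup>2)"
    proof (rule AE_I2)
      fix x
      have "norm (f x) \<le> 1 + (norm (f x))\<^sup>2"
        using sum_squares_ge_zero[of "norm (f x) - 1/2" 0] by (simp add: power2_eq_square algebra_simps)
      then show "norm (f x) \<le> norm (1 + (norm (f x))\<^sup>2)" by simp
    qed
  qed (use f in \<open>auto simp: L2_def\<close>)
qed

lemma L2_norm_nonneg: "0 \<le> L2_norm b f"
  by (simp add: L2_norm_def)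

lemma L2_norm_sq: "(L2_norm b f)\<^sup>2 = (\<integral>x. (norm (f x))\<^sup>2 \<partial>leb b)"
  by (simp add: L2_norm_def)

lemma L2_norm_eq_0: "f \<in> L2 b \<Longrightarrow> L2_norm b f = 0 \<longleftrightarrow> L2_eq b f (\<lambda>x. 0)"
  by (simp add: L2_norm_def L2_def L2_eq_def integral_nonneg_eq_0_iff_AE)

lemma integral_leb_const: "0 \<le> b \<Longrightarrow> (\<integral>x. (c::real) \<partial>leb b) = c * b"
  by (simp add: measure_restrict_space)

text \<open>The constant comes from \<open>(s + d)\<^sup>2 \<le> 2 s\<^sup>2 + 2 d\<^sup>2\<close>, integrated over an
  interval of length \<open>b\<close>.\<close>

lemma L2_norm_le:
  fixes f :: "real \<Rightarrow> 'a::euclidean_space" and g :: "real \<Rightarrow> 'b::euclidean_space"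
  assumes "f \<in> borel_measurable (leb b)" "AE x in leb b. norm (f x) \<le> norm (g x) + D * L2_norm b g"
    and g: "g \<in> L2 b" and "0 \<le> b"
  shows "L2_norm b f \<le> sqrt (2 + 2 * D\<^sup>2 * b) * L2_norm b g"
proof -
  let ?N = "L2_norm b g"
  interpret finite_measure "leb b" by (rule finite_measure_leb)
  have f: "f \<in> L2 b" using L2_dominated[OF assms(1,2,3)] .
  have "(L2_norm b f)\<^sup>2 \<le> (\<integral>x. 2 * (norm (g x))\<^sup>2 + 2 * (D * ?N)\<^sup>2 \<partial>leb b)"
    unfolding L2_norm_sq
  proof (rule integral_mono_AE)
    show "AE x in leb b. (norm (f x))\<^sup>2 \<le> 2 * (norm (g x))\<^sup>2 + 2 * (D * ?N)\<^sup>2"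
      using assms(2)
    proof eventually_elim
      case (elim x)
      have "(norm (f x))\<^sup>2 \<le> (norm (g x) + D * ?N)\<^sup>2" using elim by (intro power_mono) auto
      also have "\<dots> \<le> 2 * (norm (g x))\<^sup>2 + 2 * (D * ?N)\<^sup>2"
        using sum_squares_ge_zero[of "norm (g x) - D * ?N" 0] by (simp add: power2_eq_square algebra_simps)
      finally show ?case by simp
    qed
  qed (use f g in \<open>auto simp: L2_def\<close>)
  also have "\<dots> = (2 + 2 * D\<^sup>2 * b) * ?N\<^sup>2"
    using L2_sq_integrable[OF g] \<open>0 \<le> b\<close>
    by (simp add: Bochner_Integration.integral_add L2_norm_sq[of b g, symmetric] power_mult_distrib algebra_simps
      measure_restrict_space)
  finally have "L2_norm b f \<le> sqrt ((2 + 2 * D\<^sup>2 * b) * ?N\<^sup>2)" by (rule real_le_rsqrt)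
  also have "\<dots> = sqrt (2 + 2 * D\<^sup>2 * b) * ?N" by (simp add: real_sqrt_mult L2_norm_nonneg)
  finally show ?thesis .
qed

text \<open>Integrate the square of \<open>norm (f x) - m / b\<close>, where \<open>m / b\<close> is the mean value of
  \<open>norm (f x)\<close>.\<close>

lemma L1_le_L2_norm:
  assumes f: "f \<in> L2 b" and b: "0 < b"
  shows "(\<integral>x. norm (f x) \<partial>leb b) \<le> sqrt b * L2_norm b f"
proof -
  interpret finite_measure "leb b" by (rule finite_measure_leb)
  define m where "m = (\<integral>x. norm (f x) \<partial>leb b)"
  have 0: "integrable (leb b) (\<lambda>x. norm (f x))" using L2_integrable[OF f] by simp
  have "0 \<le> (\<integral>x. (norm (f x) - m / b)\<^sup>2 \<partial>leb b)" by simp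
  also have "\<dots> = (\<integral>x. (norm (f x))\<^sup>2 + (- 2 * (m / b)) * norm (f x) + (m / b)\<^sup>2 \<partial>leb b)"
    by (intro arg_cong[where f="integral\<^sup>L _"] ext) (simp add: power2_eq_square algebra_simps)
  also have "\<dots> = (L2_norm b f)\<^sup>2 + (- 2 * (m / b)) * m + (m / b)\<^sup>2 * b"
    using b 0 L2_sq_integrable[OF f]
    by (simp add: Bochner_Integration.integral_add L2_norm_sq m_def[symmetric] measure_restrict_space)
  also have "\<dots> = (L2_norm b f)\<^sup>2 - m\<^sup>2 / b"
    using b by (simp add: field_simps power2_eq_square)
  finally have "m\<^sup>2 \<le> b * (L2_norm b f)\<^sup>2" using b by (simp add: field_simps)
  then have "m \<le> sqrt (b * (L2_norm b f)\<^sup>2)" by (rule real_le_rsqrt)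
  then show ?thesis by (simp add: real_sqrt_mult L2_norm_nonneg m_def)
qed

lemma L2_eq_refl: "L2_eq b f f" by (simp add: L2_eq_def)
lemma L2_eq_sym: "L2_eq b f g \<Longrightarrow> L2_eq b g f" by (simp add: L2_eq_def eq_commute)
lemma L2_eq_trans [trans]: "L2_eq b f g \<Longrightarrow> L2_eq b g h \<Longrightarrow> L2_eq b f h"
  unfolding L2_eq_def by (rule AE_mp) auto

lemma L2_eqI: "(\<And>x. 0 < x \<Longrightarrow> x < b \<Longrightarrow> f x = g x) \<Longrightarrow> L2_eq b f g"
  unfolding L2_eq_def by (intro AE_I2) auto

lemma L2_eq_mono: "L2_eq b f g \<Longrightarrow> a \<le> b \<Longrightarrow> L2_eq a f g"
  by (auto simp: L2_eq_def AE_restrict_space_iff elim!: eventually_mono)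

lemma L2_norm_cong: "L2_eq b f g \<Longrightarrow> f \<in> L2 b \<Longrightarrow> g \<in> L2 b \<Longrightarrow> L2_norm b f = L2_norm b g"
  unfolding L2_norm_def L2_eq_def
  by (auto intro!: integral_cong_AE elim!: eventually_mono simp: L2_def)

text \<open>This uses completeness of Lebesgue measure. It lets operators be changed freely within an
  \<open>L2_eq\<close> class.\<close>

lemma measurable_leb_AE:
  fixes f :: "real \<Rightarrow> 'a::euclidean_space"
  assumes "f \<in> borel_measurable (leb b)" "AE x in leb b. f x = g x"
  shows "g \<in> borel_measurable (leb b)"
proof -
  have "(\<lambda>x. if x \<in> {0<..<b} then f x else 0) \<in> borel_measurable lebesgue"
    using assms(1) by (intro borel_measurable_if_I) auto
  then have "(\<lambda>x. if x \<in> {0<..<b} then g x else 0) \<in> borel_measurable lebesgue"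
    by (rule borel_measurable_AE) (use assms(2) in \<open>auto simp: AE_restrict_space_iff elim!: eventually_mono\<close>)
  then show ?thesis by (rule borel_measurable_if_D)
qed

text \<open>By completeness either both functions are measurable or neither is, and in the latter case both integrals
  are 0.\<close>

lemma integral_leb_cong:
  fixes f :: "real \<Rightarrow> 'a::euclidean_space"
  assumes "AE x in leb b. f x = g x"
  shows "(\<integral>x. f x \<partial>leb b) = (\<integral>x. g x \<partial>leb b)"
proof (cases "f \<in> borel_measurable (leb b)")
  case True
  show ?thesis using assms by (intro integral_cong_AE True measurable_leb_AE[OF True]) auto
next
  case False
  then have "g \<notin> borel_measurable (leb b)"
    using measurable_leb_AE[of g b f] assms by (auto simp: eq_commute)
  then show ?thesis using False by (metis not_integrable_integral_eq borel_measurable_integrable)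
qed

lemma integral_leb_restrict:
  fixes f :: "real \<Rightarrow> 'a::euclidean_space"
  assumes "x \<le> b"
  shows "(\<integral>t. f t \<partial>leb x) = (\<integral>t. (if t < x then f t else 0) \<partial>leb b)"
proof -
  have "(\<integral>t. f t \<partial>leb x) = (\<integral>t. (if t \<in> {0<..<x} then f t else 0) \<partial>leb b)"
    using assms by (intro integral_restrict[symmetric]) auto
  also have "\<dots> = (\<integral>t. (if t < x then f t else 0) \<partial>leb b)"
    by (intro integral_leb_cong AE_I2) auto
  finally show ?thesis .
qed

lemma L2_eq_L2: "L2_eq b f g \<Longrightarrow> f \<in> L2 b \<Longrightarrow> g \<in> L2 b"
  by (rule L2_dominated[of g b f 0]) (auto simp: L2_eq_def intro: measurable_leb_AE[OF L2_measurable])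

section \<open>Bounded operators, inverses and adjoints\<close>

lemma L2_bounded_op_L2: "L2_bounded_op a b F \<Longrightarrow> f \<in> L2 a \<Longrightarrow> F f \<in> L2 b"
  by (simp add: L2_bounded_op_def)

lemma L2_bounded_op_lin: "L2_bounded_op a b F \<Longrightarrow> f \<in> L2 a \<Longrightarrow> g \<in> L2 a \<Longrightarrow>
  L2_eq b (F (\<lambda>x. c *s f x + d *s g x)) (\<lambda>x. c *s F f x + d *s F g x)"
  by (simp add: L2_bounded_op_def)

lemma L2_bounded_op_diff: "L2_bounded_op a b F \<Longrightarrow> f \<in> L2 a \<Longrightarrow> g \<in> L2 a \<Longrightarrow>
  L2_eq b (F (\<lambda>x. f x - g x)) (\<lambda>x. F f x - F g x)"
  using L2_bounded_op_lin[of a b F f g 1 "-1"] by simp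

lemma L2_bounded_op_bound:
  assumes "L2_bounded_op a b F"
  obtains C where "0 \<le> C" "\<And>f. f \<in> L2 a \<Longrightarrow> L2_norm b (F f) \<le> C * L2_norm a f"
proof -
  obtain C where C: "\<forall>f\<in>L2 a. L2_norm b (F f) \<le> C * L2_norm a f"
    using assms unfolding L2_bounded_op_def by blast
  have "L2_norm b (F f) \<le> \<bar>C\<bar> * L2_norm a f" if "f \<in> L2 a" for f
    using C that mult_right_mono[OF abs_ge_self[of C] L2_norm_nonneg[of a f]] by fastforce
  then show ?thesis by (rule that[rotated]) auto
qed

lemma L2_eq_diff_0: "L2_eq b (\<lambda>x. f x - g x) (\<lambda>x. 0) \<longleftrightarrow> L2_eq b f g"
  by (simp add: L2_eq_def)

text \<open>Operators act on representatives, and being bounded and linear up to null sets is all that is known of them.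
  This already makes them respect \<open>L2_eq\<close>, because the image of \<open>f - g\<close> has norm 0.\<close>

lemma L2_bounded_op_cong:
  assumes F: "L2_bounded_op a b F" and f: "f \<in> L2 a" and g: "g \<in> L2 a" and eq: "L2_eq a f g"
  shows "L2_eq b (F f) (F g)"
proof -
  let ?h = "\<lambda>x. f x - g x"
  have h: "?h \<in> L2 a" using f g by (rule L2_diff)
  obtain C where C: "\<And>f. f \<in> L2 a \<Longrightarrow> L2_norm b (F f) \<le> C * L2_norm a f"
    using L2_bounded_op_bound[OF F] by blast
  have "L2_norm a ?h = 0" using eq h by (simp add: L2_norm_eq_0 L2_eq_diff_0)
  then have "L2_norm b (F ?h) = 0" using C[OF h] L2_norm_nonneg[of b "F ?h"] by simp
  then have "L2_eq b (F ?h) (\<lambda>x. 0)" using L2_bounded_op_L2[OF F h] by (simp add: L2_norm_eq_0)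
  with L2_eq_sym[OF L2_bounded_op_diff[OF F f g]] have "L2_eq b (\<lambda>x. F f x - F g x) (\<lambda>x. 0)" by (rule L2_eq_trans)
  then show ?thesis by (simp add: L2_eq_diff_0)
qed

lemma L2_eq_lin: "L2_eq b f f' \<Longrightarrow> L2_eq b g g' \<Longrightarrow>
  L2_eq b (\<lambda>x. c *s f x + d *s g x) (\<lambda>x. c *s f' x + d *s g' x)"
  unfolding L2_eq_def by (auto elim: eventually_elim2)

lemma L2_bounded_op_comp:
  assumes F: "L2_bounded_op b c F" and G: "L2_bounded_op a b G"
  shows "L2_bounded_op a c (\<lambda>f. F (G f))"
  unfolding L2_bounded_op_def
proof (intro conjI ballI allI)
  note FL = L2_bounded_op_L2[OF F] and GL = L2_bounded_op_L2[OF G]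
  show "F (G f) \<in> L2 c" if "f \<in> L2 a" for f using FL GL that by blast
  show "L2_eq c (F (G (\<lambda>x. s *s f x + t *s g x))) (\<lambda>x. s *s F (G f) x + t *s F (G g) x)"
    if "f \<in> L2 a" "g \<in> L2 a" for f g s t
  proof -
    have "L2_eq c (F (G (\<lambda>x. s *s f x + t *s g x))) (F (\<lambda>x. s *s G f x + t *s G g x))"
      by (intro L2_bounded_op_cong[OF F] GL L2_lin L2_bounded_op_lin[OF G] that)
    also have "L2_eq c (F (\<lambda>x. s *s G f x + t *s G g x)) (\<lambda>x. s *s F (G f) x + t *s F (G g) x)"
      by (intro L2_bounded_op_lin[OF F] GL that)
    finally show ?thesis .
  qed
  obtain C where C: "\<And>f. f \<in> L2 a \<Longrightarrow> L2_norm b (G f) \<le> C * L2_norm a f"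
    using L2_bounded_op_bound[OF G] by blast
  obtain D where D: "0 \<le> D" "\<And>f. f \<in> L2 b \<Longrightarrow> L2_norm c (F f) \<le> D * L2_norm b f"
    using L2_bounded_op_bound[OF F] by blast
  have "L2_norm c (F (G f)) \<le> (D * C) * L2_norm a f" if "f \<in> L2 a" for f
  proof -
    have "L2_norm c (F (G f)) \<le> D * L2_norm b (G f)" using D GL that by blast
    also have "\<dots> \<le> D * (C * L2_norm a f)" by (intro mult_left_mono C that D)
    finally show ?thesis by simp
  qed
  then show "\<exists>C. \<forall>f\<in>L2 a. L2_norm c (F (G f)) \<le> C * L2_norm a f" by blast
qed

text \<open>With the adjoint and the inverse known only up to \<open>L2_eq\<close>, properties are proved for an
  explicit operator and carried over to the chosen one.\<close>

lemma L2_bounded_op_transfer: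
  assumes F: "L2_bounded_op a b F" and eq: "\<And>f. f \<in> L2 a \<Longrightarrow> L2_eq b (F f) (F' f)"
  shows "L2_bounded_op a b F'"
  unfolding L2_bounded_op_def
proof (intro conjI ballI allI)
  show F': "F' f \<in> L2 b" if "f \<in> L2 a" for f
    using L2_eq_L2[OF eq[OF that] L2_bounded_op_L2[OF F that]] .
  show "L2_eq b (F' (\<lambda>x. c *s f x + d *s g x)) (\<lambda>x. c *s F' f x + d *s F' g x)"
    if "f \<in> L2 a" "g \<in> L2 a" for f g c d
    by (rule L2_eq_trans[OF L2_eq_sym[OF eq[OF L2_lin[OF that]]] L2_eq_trans[OF L2_bounded_op_lin[OF F that]
      L2_eq_lin[OF eq[OF that(1)] eq[OF that(2)]]]])
  obtain C where C: "\<And>f. f \<in> L2 a \<Longrightarrow> L2_norm b (F f) \<le> C * L2_norm a f"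
    using L2_bounded_op_bound[OF F] by blast
  then show "\<exists>C. \<forall>f\<in>L2 a. L2_norm b (F' f) \<le> C * L2_norm a f"
    using L2_norm_cong[OF eq L2_bounded_op_L2[OF F] F'] by (intro exI[of _ C]) auto
qed

lemma L2_inv_spec: "\<exists>G. L2_bounded_inverse b F G \<Longrightarrow> L2_bounded_inverse b F (L2_inv b F)"
  using someI_ex[of "L2_bounded_inverse b F"] by (simp add: L2_inv_def)

lemma L2_bounded_inverseD:
  assumes "L2_bounded_inverse b F G"
  shows "L2_bounded_op b b G" "f \<in> L2 b \<Longrightarrow> L2_eq b (G (F f)) f" "f \<in> L2 b \<Longrightarrow> L2_eq b (F (G f)) f"
    "f \<in> L2 b \<Longrightarrow> G f \<in> L2 b"
  using assms by (auto simp: L2_bounded_inverse_def L2_bounded_op_L2)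

lemma L2_bounded_inverse_transfer:
  fixes F F' G :: "(real \<Rightarrow> complex^'n::finite) \<Rightarrow> (real \<Rightarrow> complex^'n)"
  assumes G: "L2_bounded_inverse b F G" and F: "L2_bounded_op b b F"
    and eq: "\<And>f. f \<in> L2 b \<Longrightarrow> L2_eq b (F f) (F' f)"
  shows "L2_bounded_inverse b F' G"
  unfolding L2_bounded_inverse_def
proof (intro conjI ballI L2_bounded_inverseD(1)[OF G])
  note G' = L2_bounded_inverseD[OF G]
  fix f :: "real \<Rightarrow> complex^'n" assume f: "f \<in> L2 b"
  note Ff = L2_bounded_op_L2[OF F f]
  show "L2_eq b (G (F' f)) f"
    by (rule L2_eq_trans[OF L2_bounded_op_cong[OF G'(1) L2_eq_L2[OF eq[OF f] Ff] Ff L2_eq_sym[OF eq[OF f]]] G'(2)[OF f]])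
  show "L2_eq b (F' (G f)) f"
    by (rule L2_eq_trans[OF L2_eq_sym[OF eq[OF G'(4)[OF f]]] G'(3)[OF f]])
qed

lemma L2_bounded_inverse_inj:
  assumes G: "L2_bounded_inverse b F G" and fg: "f \<in> L2 b" "g \<in> L2 b" "F f \<in> L2 b" "F g \<in> L2 b"
    and eq: "L2_eq b (F f) (F g)"
  shows "L2_eq b f g"
  by (rule L2_eq_trans[OF L2_eq_sym[OF L2_bounded_inverseD(2)[OF G fg(1)]] L2_eq_trans[OF
      L2_bounded_op_cong[OF L2_bounded_inverseD(1)[OF G] fg(3,4) eq] L2_bounded_inverseD(2)[OF G fg(2)]]])

text \<open>A choice of preimages is automatically linear up to null sets because \<open>F\<close> is injective, and it
  is bounded by the estimate in the second assumption.\<close>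

lemma ex_L2_bounded_inverseI:
  assumes F: "L2_bounded_op b b F"
    and surj: "\<And>f. f \<in> L2 b \<Longrightarrow> \<exists>g\<in>L2 b. L2_eq b (F g) f \<and> L2_norm b g \<le> C * L2_norm b f"
    and inj: "\<And>g. g \<in> L2 b \<Longrightarrow> L2_eq b (F g) (\<lambda>x. 0) \<Longrightarrow> L2_eq b g (\<lambda>x. 0)"
  shows "\<exists>G. L2_bounded_inverse b F G"
proof -
  have inj2: "L2_eq b f g" if fg: "f \<in> L2 b" "g \<in> L2 b" "L2_eq b (F f) (F g)" for f g
    using inj[OF L2_diff[OF fg(1,2)] L2_eq_trans[OF L2_bounded_op_diff[OF F fg(1,2)]]] fg(3) by (simp add: L2_eq_diff_0)
  from surj obtain G where G: "\<And>f. f \<in> L2 b \<Longrightarrow> G f \<in> L2 b" "\<And>f. f \<in> L2 b \<Longrightarrow> L2_eq b (F (G f)) f"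
    "\<And>f. f \<in> L2 b \<Longrightarrow> L2_norm b (G f) \<le> C * L2_norm b f" by metis
  have "L2_eq b (G (\<lambda>x. c *s f x + d *s g x)) (\<lambda>x. c *s G f x + d *s G g x)"
    if fg: "f \<in> L2 b" "g \<in> L2 b" for f g c d
  proof (rule inj2)
    have "L2_eq b (F (G (\<lambda>x. c *s f x + d *s g x))) (\<lambda>x. c *s f x + d *s g x)"
      by (intro G L2_lin fg)
    also have "L2_eq b (\<lambda>x. c *s f x + d *s g x) (\<lambda>x. c *s F (G f) x + d *s F (G g) x)"
      by (intro L2_eq_lin L2_eq_sym[OF G(2)] fg)
    also have "L2_eq b (\<lambda>x. c *s F (G f) x + d *s F (G g) x) (F (\<lambda>x. c *s G f x + d *s G g x))"
      by (intro L2_eq_sym[OF L2_bounded_op_lin[OF F]] G fg)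
    finally show "L2_eq b (F (G (\<lambda>x. c *s f x + d *s g x))) (F (\<lambda>x. c *s G f x + d *s G g x))" .
  qed (simp_all add: G L2_lin fg)
  moreover have "L2_eq b (G (F f)) f" if "f \<in> L2 b" for f
    by (rule inj2) (simp_all add: G L2_bounded_op_L2[OF F] that)
  ultimately have "L2_bounded_inverse b F G"
    using G(1,2,3) unfolding L2_bounded_inverse_def L2_bounded_op_def by (intro conjI exI[of _ C] ballI allI) simp_all
  then show ?thesis by blast
qed

lemma measurable_bilinear:
  fixes B :: "'a::euclidean_space \<Rightarrow> 'b::euclidean_space \<Rightarrow> 'c::euclidean_space"
  assumes B: "bounded_bilinear B" and "f \<in> borel_measurable M" "g \<in> borel_measurable M"
  shows "(\<lambda>x. B (f x) (g x)) \<in> borel_measurable M"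
  by (rule borel_measurable_continuous_Pair[OF assms(2,3)])
    (rule bounded_bilinear.continuous_on[OF B continuous_on_fst[OF continuous_on_id] continuous_on_snd[OF continuous_on_id]])

lemma integrable_cinner:
  assumes "f \<in> L2 b" "g \<in> L2 b"
  shows "integrable (leb b) (\<lambda>x. cinner (f x) (g x))"
proof (rule Bochner_Integration.integrable_bound)
  show "integrable (leb b) (\<lambda>x. (norm (f x))\<^sup>2 + (norm (g x))\<^sup>2)" using assms by (auto simp: L2_def)
  show "(\<lambda>x. cinner (f x) (g x)) \<in> borel_measurable (leb b)"
    by (rule measurable_bilinear[OF bounded_bilinear_cinner L2_measurable[OF assms(1)] L2_measurable[OF assms(2)]])
  show "AE x in leb b. norm (cinner (f x) (g x)) \<le> norm ((norm (f x))\<^sup>2 + (norm (g x))\<^sup>2)"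
  proof (rule AE_I2)
    fix x
    have "norm (f x) * norm (g x) \<le> (norm (f x))\<^sup>2 + (norm (g x))\<^sup>2"
      using sum_squares_bound[of "norm (f x)" "norm (g x)"]
        mult_nonneg_nonneg[of "norm (f x)" "norm (g x)"] by (simp del: mult_nonneg_nonneg)
    then show "norm (cinner (f x) (g x)) \<le> norm ((norm (f x))\<^sup>2 + (norm (g x))\<^sup>2)"
      using norm_cinner_le[of "f x" "g x"] by simp
  qed
qed

lemma L2_inner_cong: "L2_eq b f f' \<Longrightarrow> L2_eq b g g' \<Longrightarrow> L2_inner b f g = L2_inner b f' g'"
  unfolding L2_inner_def L2_eq_def by (intro integral_leb_cong) (auto elim: eventually_elim2)

lemma L2_inner_add_left:
  assumes "f \<in> L2 b" "g \<in> L2 b" "h \<in> L2 b"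
  shows "L2_inner b (\<lambda>x. f x + g x) h = L2_inner b f h + L2_inner b g h"
  unfolding L2_inner_def using integrable_cinner[of f b h] integrable_cinner[of g b h] assms
  by (simp add: bounded_bilinear.add_left[OF bounded_bilinear_cinner])

lemma L2_inner_add_right:
  assumes "f \<in> L2 b" "g \<in> L2 b" "h \<in> L2 b"
  shows "L2_inner b h (\<lambda>x. f x + g x) = L2_inner b h f + L2_inner b h g"
  unfolding L2_inner_def using integrable_cinner[of h b f] integrable_cinner[of h b g] assms
  by (simp add: bounded_bilinear.add_right[OF bounded_bilinear_cinner])

lemma L2_inner_diff_right:
  assumes "f \<in> L2 b" "g \<in> L2 b" "h \<in> L2 b"
  shows "L2_inner b f (\<lambda>x. g x - h x) = L2_inner b f g - L2_inner b f h"
  unfolding L2_inner_def using integrable_cinner[of f b g] integrable_cinner[of f b h] assms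
  by (simp add: bounded_bilinear.diff_right[OF bounded_bilinear_cinner])

lemma L2_inner_self: "L2_inner b f f = of_real ((L2_norm b f)\<^sup>2)"
  by (simp add: L2_inner_def cinner_self L2_norm_sq del: of_real_power)

text \<open>Test with \<open>f = g - h\<close>.\<close>

lemma L2_eqI_inner:
  assumes g: "g \<in> L2 b" and h: "h \<in> L2 b" and eq: "\<And>f. f \<in> L2 b \<Longrightarrow> L2_inner b f g = L2_inner b f h"
  shows "L2_eq b g h"
proof -
  have d: "(\<lambda>x. g x - h x) \<in> L2 b" by (intro L2_diff g h)
  have "L2_inner b (\<lambda>x. g x - h x) (\<lambda>x. g x - h x) = 0"
    using L2_inner_diff_right[OF d g h] eq[OF d] by simp
  then have "L2_norm b (\<lambda>x. g x - h x) = 0" by (simp add: L2_inner_self)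
  then show ?thesis using d by (simp add: L2_norm_eq_0 L2_eq_diff_0)
qed

text \<open>An adjoint picked by Hilbert choice has the adjoint property as soon as some adjoint is known.\<close>

lemma adj_op_spec:
  assumes "\<And>y. y \<in> Y \<Longrightarrow> G y \<in> X" "\<And>x y. x \<in> X \<Longrightarrow> y \<in> Y \<Longrightarrow> ipY (F x) y = ipX x (G y)"
  shows "y \<in> Y \<Longrightarrow> adj_op X ipX Y ipY F y \<in> X"
    "x \<in> X \<Longrightarrow> y \<in> Y \<Longrightarrow> ipY (F x) y = ipX x (adj_op X ipX Y ipY F y)"
proof -
  have "\<exists>G. \<forall>y\<in>Y. G y \<in> X \<and> (\<forall>x\<in>X. ipY (F x) y = ipX x (G y))" using assms by blast
  from someI_ex[OF this, folded adj_op_def]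
  show "y \<in> Y \<Longrightarrow> adj_op X ipX Y ipY F y \<in> X"
    "x \<in> X \<Longrightarrow> y \<in> Y \<Longrightarrow> ipY (F x) y = ipX x (adj_op X ipX Y ipY F y)" by blast+
qed

lemma L2_adj_eq:
  assumes G: "\<And>y. y \<in> L2 b \<Longrightarrow> G y \<in> L2 a"
    and adj: "\<And>x y. x \<in> L2 a \<Longrightarrow> y \<in> L2 b \<Longrightarrow> L2_inner b (F x) y = L2_inner a x (G y)"
    and y: "y \<in> L2 b"
  shows "L2_adj a b F y \<in> L2 a" "L2_eq a (L2_adj a b F y) (G y)"
proof -
  note spec = adj_op_spec[where X="L2 a" and ipX="L2_inner a" and Y="L2 b" and ipY="L2_inner b" and F=F and G=G,
    OF G adj, simplified L2_adj_def[symmetric]]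
  show *: "L2_adj a b F y \<in> L2 a" by (rule spec(1)) (simp_all add: y)
  show "L2_eq a (L2_adj a b F y) (G y)"
    by (rule L2_eqI_inner[OF * G[OF y]]) (rule trans[OF spec(2)[symmetric] adj], simp_all add: y)
qed

section \<open>Volterra equations\<close>

lemma integral_leb_FTC:
  fixes f F :: "real \<Rightarrow> 'a::euclidean_space"
  assumes "c \<le> d" and F: "\<And>x. x \<in> {c..d} \<Longrightarrow> (F has_vector_derivative f x) (at x within {c..d})"
    and f: "continuous_on {c..d} f"
  shows "(\<integral>x. f x \<partial>lebesgue_on {c<..<d}) = F d - F c"
proof -
  have "(f has_integral (F d - F c)) {c..d}"
    by (intro fundamental_theorem_of_calculus F assms)
  then have i: "integral {c<..<d} f = F d - F c"
    by (metis box_real(1,2) has_integral_Icc_iff_Ioo integral_unique)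
  have "f absolutely_integrable_on {c..d}"
    using f absolutely_integrable_continuous[of c d f] by (simp add: cbox_interval)
  then have "f absolutely_integrable_on {c<..<d}"
    by (rule set_integrable_subset) auto
  then have "integrable (lebesgue_on {c<..<d}) f"
    by (simp add: integrable_restrict_space set_integrable_def)
  from lebesgue_integral_eq_integral[OF this] show ?thesis using i by simp
qed

lemmas measurable_mv = measurable_bilinear[OF bounded_bilinear_mv]

definition int_op :: "real \<Rightarrow> (real \<Rightarrow> real \<Rightarrow> complex^'n::finite^'n) \<Rightarrow> (real \<Rightarrow> complex^'n) \<Rightarrow> real \<Rightarrow> complex^'n"
  where "int_op b k f x = (\<integral>t. k x t *v f t \<partial>leb b)"

text \<open>Equality everywhere, since the values of an integral operator do not depend on the representative of its
  argument.\<close>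

lemma int_op_cong: "L2_eq b f g \<Longrightarrow> int_op b k f = int_op b k g"
  unfolding int_op_def L2_eq_def by (intro ext integral_leb_cong) auto

text \<open>The weight \<open>w\<close> fixes the direction of time. For \<open>w x = x\<close> the kernel is lower triangular and the integral
  runs over \<open>(0,x)\<close>; for \<open>w x = b - x\<close> it is upper triangular and the integral runs over \<open>(x,b)\<close>, as happens for
  adjoints. In both cases the integral at \<open>x\<close> extends over the points of smaller weight, and the weight is all
  that the estimates see, so that \<open>V\<close> and \<open>V\<^sup>*\<close> are treated at once.\<close>

locale volterra =
  fixes b C :: real and w :: "real \<Rightarrow> real" and k :: "real \<Rightarrow> real \<Rightarrow> complex^'n::finite^'n"
  assumes b: "0 < b" and w: "w = (\<lambda>x. x) \<or> w = (\<lambda>x. b - x)"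
    and k_meas: "(\<lambda>(x, t). k x t) \<in> borel_measurable (leb b \<Otimes>\<^sub>M leb b)"
    and k_bound: "\<And>x t. x \<in> {0<..<b} \<Longrightarrow> t \<in> {0<..<b} \<Longrightarrow> norm (k x t) \<le> C"
    and k_zero: "\<And>x t. x \<in> {0<..<b} \<Longrightarrow> t \<in> {0<..<b} \<Longrightarrow> \<not> w t < w x \<Longrightarrow> k x t = 0"
begin

sublocale finite_measure "leb b" by (rule finite_measure_leb)

abbreviation "N \<equiv> int_op b k"

lemma C_nonneg: "0 \<le> C"
  using k_bound[of "b/2" "b/2"] b norm_ge_zero[of "k (b/2) (b/2)"] by (simp del: norm_ge_zero)

lemma w_measurable: "w \<in> borel_measurable (leb b)"
  using w by (auto intro!: measurable_leb_borel)

lemma w_bounds: "x \<in> {0<..<b} \<Longrightarrow> 0 < w x \<and> w x < b"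
  using w by auto

lemma k_section: "x \<in> {0<..<b} \<Longrightarrow> k x \<in> borel_measurable (leb b)"
  using measurable_Pair2[OF k_meas, of x] by simp

lemma N_measurable: "f \<in> borel_measurable (leb b) \<Longrightarrow> N f \<in> borel_measurable (leb b)"
proof -
  assume f: "f \<in> borel_measurable (leb b)"
  have "(\<lambda>p. (case p of (x, t) \<Rightarrow> k x t) *v f (snd p)) \<in> borel_measurable (leb b \<Otimes>\<^sub>M leb b)"
    by (rule measurable_mv[OF k_meas measurable_compose[OF measurable_snd f]])
  then have "(\<lambda>(x, t). k x t *v f t) \<in> borel_measurable (leb b \<Otimes>\<^sub>M leb b)"
    by (simp add: case_prod_beta)
  from borel_measurable_lebesgue_integral[OF this] show ?thesis
    by (simp add: int_op_def[abs_def])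
qed

lemma kernel_norm_le:
  assumes "x \<in> {0<..<b}" "t \<in> {0<..<b}"
  shows "norm (k x t *v y) \<le> C * (if w t < w x then norm y else 0)"
  using order_trans[OF norm_mv mult_right_mono[OF k_bound[OF assms] norm_ge_zero]] k_zero[OF assms]
  by auto

lemma kernel_integrable:
  assumes x: "x \<in> {0<..<b}" and f: "integrable (leb b) f"
  shows "integrable (leb b) (\<lambda>t. k x t *v f t)"
proof (rule Bochner_Integration.integrable_bound)
  show "integrable (leb b) (\<lambda>t. C * norm (f t))" using f by simp
  show "(\<lambda>t. k x t *v f t) \<in> borel_measurable (leb b)"
    by (rule measurable_mv[OF k_section[OF x] borel_measurable_integrable[OF f]])
  show "AE t in leb b. norm (k x t *v f t) \<le> norm (C * norm (f t))"
  proof (rule AE_I2)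
    fix t assume "t \<in> space (leb b)"
    then have "norm (k x t *v f t) \<le> C * (if w t < w x then norm (f t) else 0)"
      using kernel_norm_le[OF x] by simp
    also have "\<dots> \<le> C * norm (f t)" by (intro mult_left_mono C_nonneg) auto
    finally show "norm (k x t *v f t) \<le> norm (C * norm (f t))" using C_nonneg by simp
  qed
qed

lemma N_lin:
  assumes x: "x \<in> {0<..<b}" and f: "f \<in> L2 b" "g \<in> L2 b"
  shows "N (\<lambda>t. c *s f t + d *s g t) x = c *s N f x + d *s N g x"
proof -
  note i = kernel_integrable[OF x L2_integrable[OF f(1)]] kernel_integrable[OF x L2_integrable[OF f(2)]]
  have "k x t *v (c *s f t + d *s g t) = c *s (k x t *v f t) + d *s (k x t *v g t)" for t
    by (simp add: matrix_vector_right_distrib vector_scalar_commute)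
  then have "N (\<lambda>t. c *s f t + d *s g t) x = (\<integral>t. c *s (k x t *v f t) + d *s (k x t *v g t) \<partial>leb b)"
    by (simp add: int_op_def)
  also have "\<dots> = c *s N f x + d *s N g x"
    unfolding int_op_def
    using i by (subst Bochner_Integration.integral_add)
      (auto simp: integral_bounded_linear[OF bounded_linear_vscale] integrable_bounded_linear[OF bounded_linear_vscale])
  finally show ?thesis .
qed

lemma integrable_cutoff:
  assumes f: "integrable (leb b) (f :: real \<Rightarrow> real)"
  shows "integrable (leb b) (\<lambda>t. if w t < y then f t else 0)"
proof (rule Bochner_Integration.integrable_bound[OF f])
  have "{t \<in> space (leb b). w t < y} \<in> sets (leb b)"
    using borel_measurable_less[OF w_measurable, of "\<lambda>_. y"] by simp
  then show "(\<lambda>t. if w t < y then f t else 0) \<in> borel_measurable (leb b)"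
    by (intro measurable_If borel_measurable_integrable[OF f]) auto
qed auto

lemma N_norm_le:
  assumes x: "x \<in> {0<..<b}" and f: "integrable (leb b) f"
  shows "norm (N f x) \<le> C * (\<integral>t. (if w t < w x then norm (f t) else 0) \<partial>leb b)"
proof -
  have m: "integrable (leb b) (\<lambda>t. if w t < w x then norm (f t) else 0)"
    by (rule integrable_cutoff[OF integrable_norm[OF f]])
  have "norm (N f x) \<le> (\<integral>t. norm (k x t *v f t) \<partial>leb b)"
    unfolding int_op_def by (rule integral_norm_bound)
  also have "\<dots> \<le> (\<integral>t. C * (if w t < w x then norm (f t) else 0) \<partial>leb b)"
  proof (rule integral_mono)
    show "integrable (leb b) (\<lambda>t. norm (k x t *v f t))" by (rule integrable_norm[OF kernel_integrable[OF x f]])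
    show "integrable (leb b) (\<lambda>t. C * (if w t < w x then norm (f t) else 0))" by (rule integrable_mult_right[OF m])
    show "norm (k x t *v f t) \<le> C * (if w t < w x then norm (f t) else 0)" if "t \<in> space (leb b)" for t
      by (rule kernel_norm_le[OF x]) (use that in simp)
  qed
  also have "\<dots> = C * (\<integral>t. (if w t < w x then norm (f t) else 0) \<partial>leb b)" by (rule integral_mult_right_zero)
  finally show ?thesis .
qed

lemma N_norm_le_L2:
  assumes x: "x \<in> {0<..<b}" and f: "f \<in> L2 b"
  shows "norm (N f x) \<le> C * sqrt b * L2_norm b f"
proof -
  have "norm (N f x) \<le> C * (\<integral>t. (if w t < w x then norm (f t) else 0) \<partial>leb b)"
    by (rule N_norm_le[OF x L2_integrable[OF f]])
  also have "\<dots> \<le> C * (\<integral>t. norm (f t) \<partial>leb b)"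
    using L2_integrable[OF f] by (intro mult_left_mono C_nonneg integral_mono') auto
  also have "\<dots> \<le> C * (sqrt b * L2_norm b f)" by (intro mult_left_mono C_nonneg L1_le_L2_norm f b)
  finally show ?thesis by simp
qed

lemma power_antiderivative:
  "((\<lambda>t :: real. t ^ Suc n / Suc n) has_real_derivative t ^ n) (at t within S)"
  by (auto intro!: derivative_eq_intros simp del: power_Suc of_nat_Suc)

lemma power_diff_antiderivative:
  "((\<lambda>t :: real. - ((c - t) ^ Suc n / Suc n)) has_real_derivative (c - t) ^ n) (at t within S)"
  by (auto intro!: derivative_eq_intros simp del: power_Suc of_nat_Suc)

text \<open>This identity is where the two directions of time are seen to behave alike: integrating a power of the
  weight gains one power and the factor \<open>1 / Suc n\<close>.\<close>

lemma w_moment: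
  assumes x: "x \<in> {0<..<b}"
  shows "(\<integral>t. (if w t < w x then w t ^ n else 0) \<partial>leb b) = w x ^ Suc n / Suc n"
  using w
proof
  assume w: "w = (\<lambda>x. x)"
  have "(\<integral>t. (if w t < w x then w t ^ n else 0) \<partial>leb b) = (\<integral>t. t ^ n \<partial>leb x)"
    using x unfolding w by (subst integral_leb_restrict[of x b]) auto
  also have "\<dots> = x ^ Suc n / Suc n - 0 ^ Suc n / Suc n"
    using x by (intro integral_leb_FTC) (auto intro!: power_antiderivative continuous_intros
      simp: has_real_derivative_iff_has_vector_derivative[symmetric] simp del: power_Suc of_nat_Suc)
  finally show ?thesis by (simp add: w)
next
  assume w: "w = (\<lambda>x. b - x)"
  have "(\<integral>t. (if w t < w x then w t ^ n else 0) \<partial>leb b) = (\<integral>t. (if t \<in> {x<..<b} then (b - t) ^ n else 0) \<partial>leb b)"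
    by (intro integral_leb_cong AE_I2) (auto simp: w)
  also have "\<dots> = (\<integral>t. (b - t) ^ n \<partial>lebesgue_on {x<..<b})"
    using x by (intro integral_restrict) auto
  also have "\<dots> = - ((b - b) ^ Suc n / Suc n) - (- ((b - x) ^ Suc n / Suc n))"
    using x by (intro integral_leb_FTC) (auto intro!: power_diff_antiderivative continuous_intros
      simp: has_real_derivative_iff_has_vector_derivative[symmetric] simp del: power_Suc of_nat_Suc)
  finally show ?thesis by (simp add: w)
qed

text \<open>Iterating this estimate produces the factorials that make the Neumann series converge for kernels of any
  size.\<close>

lemma N_norm_le_power:
  assumes x: "x \<in> {0<..<b}" and f: "f \<in> borel_measurable (leb b)"
    and le: "AE t in leb b. norm (f t) \<le> A * w t ^ n" and A: "0 \<le> A"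
  shows "norm (N f x) \<le> C * A / Suc n * w x ^ Suc n"
proof -
  have wb: "norm (w t ^ n) \<le> b ^ n" if "t \<in> {0<..<b}" for t
    using w_bounds[OF that] by (simp add: power_mono)
  have wi: "integrable (leb b) (\<lambda>t. w t ^ n)"
    using w_measurable wb by (intro integrable_const_bound[of _ "b ^ n"]) (auto intro!: AE_I2)
  have fi: "integrable (leb b) f"
  proof (rule Bochner_Integration.integrable_bound[OF _ f])
    show "integrable (leb b) (\<lambda>t. A * w t ^ n)" using wi by simp
    show "AE t in leb b. norm (f t) \<le> norm (A * w t ^ n)" using le by eventually_elim auto
  qed
  have wi2: "integrable (leb b) (\<lambda>t. if w t < w x then A * w t ^ n else 0)"
    by (rule integrable_cutoff[OF integrable_mult_right[OF wi]])
  have fi2: "integrable (leb b) (\<lambda>t. if w t < w x then norm (f t) else 0)"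
    by (rule integrable_cutoff[OF integrable_norm[OF fi]])
  have "norm (N f x) \<le> C * (\<integral>t. (if w t < w x then norm (f t) else 0) \<partial>leb b)"
    by (rule N_norm_le[OF x fi])
  also have "\<dots> \<le> C * (\<integral>t. (if w t < w x then A * w t ^ n else 0) \<partial>leb b)"
    by (intro mult_left_mono C_nonneg integral_mono_AE fi2 wi2) (use le in eventually_elim, auto)
  also have "(\<integral>t. (if w t < w x then A * w t ^ n else 0) \<partial>leb b)
    = (\<integral>t. A * (if w t < w x then w t ^ n else 0) \<partial>leb b)"
    by (intro integral_leb_cong AE_I2) auto
  also have "\<dots> = A * (w x ^ Suc n / Suc n)"
    by (simp only: integral_mult_right_zero w_moment[OF x])
  finally show ?thesis by simp
qed

lemma iterate_bound_step: "C * (M * C ^ n / fact n) / Suc n = M * C ^ Suc n / fact (Suc n)" for M :: real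
  by (simp add: field_simps)

lemma exp_terms_tendsto_0: "(\<lambda>n. M * C ^ n / fact n * y ^ n) \<longlonglongrightarrow> 0" for M y :: real
proof -
  have "(\<lambda>n. M * (inverse (fact n) * (C * y) ^ n)) \<longlonglongrightarrow> M * 0"
    by (intro tendsto_intros summable_LIMSEQ_zero summable_exp)
  then show ?thesis by (simp add: field_simps power_mult_distrib)
qed

text \<open>A solution of \<open>g = - N g\<close> is bounded by \<open>M (C w(x))\<^sup>n / n!\<close> for every
  \<open>n\<close>, and this tends to 0.\<close>

lemma injective:
  assumes g: "g \<in> L2 b" and eq: "L2_eq b (\<lambda>x. g x + N g x) (\<lambda>x. 0)"
  shows "L2_eq b g (\<lambda>x. 0)"
proof -
  \<comment> \<open>a uniform bound for \<open>N g\<close>\<close>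
  define M where "M = C * sqrt b * L2_norm b g"
  have M: "0 \<le> M" unfolding M_def using C_nonneg b by (intro mult_nonneg_nonneg L2_norm_nonneg) auto
  have eq': "AE x in leb b. norm (g x) = norm (N g x)"
    using eq unfolding L2_eq_def by eventually_elim (metis add.inverse_unique norm_minus_cancel)
  have "AE x in leb b. norm (g x) \<le> M * C ^ n / fact n * w x ^ n" for n
  proof (induction n)
    case 0
    show ?case using eq' AE_space
      by eventually_elim (use N_norm_le_L2[OF _ g] in \<open>auto simp: M_def\<close>)
  next
    case (Suc n)
    show ?case using eq' AE_space
    proof eventually_elim
      case (elim x)
      have "norm (N g x) \<le> C * (M * C ^ n / fact n) / Suc n * w x ^ Suc n"
        using elim M C_nonneg by (intro N_norm_le_power[OF _ L2_measurable[OF g] Suc]) auto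
      then show ?case using elim iterate_bound_step by metis
    qed
  qed
  then have "AE x in leb b. \<forall>n. norm (g x) \<le> M * C ^ n / fact n * w x ^ n" by (simp add: AE_all_countable)
  then have "AE x in leb b. g x = 0"
  proof eventually_elim
    case (elim x)
    have "norm (g x) \<le> 0"
      by (rule LIMSEQ_le_const[OF exp_terms_tendsto_0[of M "w x"]]) (use elim in auto)
    then show ?case by simp
  qed
  then show ?thesis by (simp add: L2_eq_def)
qed

text \<open>The integral term is bounded pointwise by a multiple of the norm of \<open>f\<close>.\<close>

lemma bounded_op: "L2_bounded_op b b (\<lambda>f x. f x + N f x)"
  unfolding L2_bounded_op_def
proof (intro conjI ballI allI)
  have m: "(\<lambda>x. f x + N f x) \<in> borel_measurable (leb b)" if "f \<in> L2 b" for f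
    using L2_measurable[OF that] N_measurable[OF L2_measurable[OF that]] by simp
  have le: "AE x in leb b. norm (f x + N f x) \<le> norm (f x) + C * sqrt b * L2_norm b f" if "f \<in> L2 b" for f
    using N_norm_le_L2[OF _ that] by (intro AE_I2 order_trans[OF norm_triangle_ineq]) auto
  show "(\<lambda>x. f x + N f x) \<in> L2 b" if "f \<in> L2 b" for f
    by (rule L2_dominated[OF m[OF that] le[OF that] that])
  show "\<exists>D. \<forall>f\<in>L2 b. L2_norm b (\<lambda>x. f x + N f x) \<le> D * L2_norm b f"
    using L2_norm_le[OF m le] b by (metis less_imp_le)
  show "L2_eq b (\<lambda>x. (c *s f x + d *s g x) + N (\<lambda>x. c *s f x + d *s g x) x)
     (\<lambda>x. c *s (f x + N f x) + d *s (g x + N g x))" if "f \<in> L2 b" "g \<in> L2 b" for f g c d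
    using N_lin[OF _ that] by (intro L2_eqI) (simp add: vector_add_ldistrib)
qed

text \<open>The solution is the Neumann series \<open>f - N f + N (N f) - \<dots>\<close>. From the second term on, its terms are bounded
  functions, defined everywhere and not just up to null sets, and they decay factorially; the series is hence summed
  pointwise and may be integrated term by term against the kernel.\<close>

lemma surjective:
  assumes f: "f \<in> L2 b"
  shows "\<exists>g\<in>L2 b. L2_eq b (\<lambda>x. g x + N g x) f \<and>
    L2_norm b g \<le> sqrt (2 + 2 * (C * sqrt b * exp (C * b))\<^sup>2 * b) * L2_norm b f"
proof -
  \<comment> \<open>a uniform bound for \<open>N f\<close>\<close>
  define M where "M = C * sqrt b * L2_norm b f"
  have M: "0 \<le> M" unfolding M_def using C_nonneg b by (intro mult_nonneg_nonneg L2_norm_nonneg) auto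
  \<comment> \<open>the terms of the Neumann series after the first, so that \<open>h n\<close> is \<open>(- N)\<close> applied \<open>n + 1\<close> times to \<open>f\<close>\<close>
  define h where "h = rec_nat (\<lambda>x. - N f x) (\<lambda>_ h x. - N h x)"
  have h0: "h 0 x = - N f x" and hS: "h (Suc n) x = - N (h n) x" for n x
    by (simp_all add: h_def)
  have hm: "h n \<in> borel_measurable (leb b)" for n
    by (induction n) (auto simp: h_def intro!: N_measurable L2_measurable[OF f] borel_measurable_uminus)
  have hb: "norm (h n x) \<le> M * C ^ n / fact n * w x ^ n" if "x \<in> {0<..<b}" for n x
    using that
  proof (induction n arbitrary: x)
    case 0
    then show ?case using N_norm_le_L2[OF _ f] by (auto simp: h0 M_def)
  next
    case (Suc n)
    have "norm (N (h n) x) \<le> C * (M * C ^ n / fact n) / Suc n * w x ^ Suc n"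
      using Suc M C_nonneg by (intro N_norm_le_power hm) (auto intro!: AE_I2)
    then show ?case using iterate_bound_step by (metis hS norm_minus_cancel)
  qed
  define B where "B n = M * (inverse (fact n) * (C * b) ^ n)" for n
  have hB: "norm (h n x) \<le> B n" if x: "x \<in> {0<..<b}" for n x
  proof -
    have "norm (h n x) \<le> M * C ^ n / fact n * w x ^ n" by (rule hb[OF x])
    also have "\<dots> \<le> M * C ^ n / fact n * b ^ n"
      using w_bounds[OF x] M C_nonneg by (intro mult_left_mono power_mono) auto
    finally show ?thesis by (simp add: B_def field_simps power_mult_distrib)
  qed
  have Bsums: "B sums (M * exp (C * b))"
    unfolding B_def using exp_converges[of "C * b"] by (intro sums_mult) (simp add: divide_inverse mult.commute)
  note Bs = sums_summable[OF Bsums]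
  have hsum: "summable (\<lambda>n. norm (h n x))" if "x \<in> {0<..<b}" for x
    by (rule summable_comparison_test'[OF Bs, of 0]) (use hB[OF that] in auto)
  define s where "s x = (\<Sum>n. h n x)" for x
  have s_le: "norm (s x) \<le> M * exp (C * b)" if "x \<in> {0<..<b}" for x
  proof -
    have "norm (s x) \<le> (\<Sum>n. norm (h n x))" unfolding s_def by (rule summable_norm[OF hsum[OF that]])
    also have "\<dots> \<le> (\<Sum>n. B n)" by (intro suminf_le hB that hsum Bs)
    also have "\<dots> = M * exp (C * b)" using Bsums by (simp add: sums_iff)
    finally show ?thesis .
  qed
  have sm: "s \<in> borel_measurable (leb b)"
    unfolding s_def[abs_def] by (intro borel_measurable_suminf hm)
  have s: "s \<in> L2 b" by (rule L2_bounded[OF sm s_le])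
  have hi: "integrable (leb b) (h n)" for n
    by (rule L2_integrable[OF L2_bounded[OF hm hB]])
  have Ns: "(\<lambda>n. N (h n) x) sums N s x" if x: "x \<in> {0<..<b}" for x
  proof -
    have le: "norm (k x t *v h n t) \<le> C * B n" if t: "t \<in> {0<..<b}" for n t
      using order_trans[OF norm_mv mult_mono[OF k_bound[OF x t] hB[OF t, of n] C_nonneg norm_ge_zero]] .
    have *: "(\<lambda>n. N (h n) x) sums (\<integral>t. (\<Sum>n. k x t *v h n t) \<partial>leb b)"
      unfolding int_op_def
    proof (rule sums_integral)
      show "integrable (leb b) (\<lambda>t. k x t *v h n t)" for n by (rule kernel_integrable[OF x hi])
      show "AE t in leb b. summable (\<lambda>n. norm (k x t *v h n t))"
        using le by (intro AE_I2 summable_comparison_test'[OF summable_mult[OF Bs, of C], of 0]) auto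
      show "summable (\<lambda>n. \<integral>t. norm (k x t *v h n t) \<partial>leb b)"
      proof (rule summable_comparison_test'[OF summable_mult2[OF summable_mult[OF Bs, of C], of b], of 0])
        fix n
        have "(\<integral>t. norm (k x t *v h n t) \<partial>leb b) \<le> (\<integral>t. C * B n \<partial>leb b)"
          using le kernel_integrable[OF x hi] by (intro integral_mono) auto
        also have "\<dots> = C * B n * b" using b by (intro integral_leb_const) auto
        finally show "norm (\<integral>t. norm (k x t *v h n t) \<partial>leb b) \<le> C * B n * b" by simp
      qed
    qed
    have "(\<integral>t. (\<Sum>n. k x t *v h n t) \<partial>leb b) = N s x"
      unfolding int_op_def s_def
    proof (rule integral_leb_cong, rule AE_I2)
      fix t assume "t \<in> space (leb b)"
      then have "summable (\<lambda>n. h n t)" by (intro summable_norm_cancel[OF hsum]) simp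
      from bounded_linear.suminf[OF bounded_bilinear.bounded_linear_right[OF bounded_bilinear_mv] this]
      show "(\<Sum>n. k x t *v h n t) = k x t *v (\<Sum>n. h n t)" by (rule sym)
    qed
    with * show ?thesis by simp
  qed
  define g where "g = (\<lambda>x. f x + s x)"
  have g: "g \<in> L2 b" unfolding g_def by (intro L2_add f s)
  have "g x + N g x = f x" if x: "x \<in> {0<..<b}" for x
  proof -
    have "N g x = N f x + N s x"
      using N_lin[OF x f s, of 1 1] by (simp add: g_def)
    also have "N s x = - (\<Sum>n. h (Suc n) x)"
      using sums_unique[OF Ns[OF x]] sums_minus[OF Ns[OF x]] by (simp add: hS sums_iff)
    also have "(\<Sum>n. h (Suc n) x) = s x - h 0 x"
      unfolding s_def using suminf_split_head[OF summable_norm_cancel[OF hsum[OF x]]] by simp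
    finally show ?thesis by (simp add: g_def h0)
  qed
  then have 1: "L2_eq b (\<lambda>x. g x + N g x) f" by (intro L2_eqI) auto
  have "L2_norm b g \<le> sqrt (2 + 2 * (C * sqrt b * exp (C * b))\<^sup>2 * b) * L2_norm b f"
  proof (rule L2_norm_le[OF L2_measurable[OF g] _ f])
    show "AE x in leb b. norm (g x) \<le> norm (f x) + C * sqrt b * exp (C * b) * L2_norm b f"
    proof (rule AE_I2)
      fix x assume "x \<in> space (leb b)"
      then have "norm (s x) \<le> M * exp (C * b)" using s_le by simp
      then show "norm (g x) \<le> norm (f x) + C * sqrt b * exp (C * b) * L2_norm b f"
        unfolding g_def using norm_triangle_ineq[of "f x" "s x"] by (simp add: M_def mult_ac)
    qed
  qed (use b in auto)
  with g 1 show ?thesis by blast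
qed

lemma invertible: "\<exists>G. L2_bounded_inverse b (\<lambda>f x. f x + N f x) G"
  by (rule ex_L2_bounded_inverseI[OF bounded_op surjective injective])

end

section \<open>Adjoint and truncation of Volterra operators\<close>

definition adj_kernel :: "(real \<Rightarrow> real \<Rightarrow> complex^'n::finite^'n) \<Rightarrow> real \<Rightarrow> real \<Rightarrow> complex^'n^'n"
  where "adj_kernel k x t = ctranspose (k t x)"

lemma ctranspose_zero [simp]: "ctranspose 0 = 0"
  by (simp add: ctranspose_def vec_eq_iff)

lemma measurable_ctranspose:
  "f \<in> borel_measurable M \<Longrightarrow> (\<lambda>x. ctranspose (f x)) \<in> borel_measurable M"
  by (rule measurable_compose[OF _ borel_measurable_continuous_onI[OF
    linear_continuous_on[OF bounded_linear_ctranspose]]])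

text \<open>Passing to the adjoint reverses the direction of time.\<close>

lemma volterra_adj:
  assumes "volterra b C (\<lambda>x. x) k"
  shows "volterra b C (\<lambda>x. b - x) (adj_kernel k)"
proof -
  interpret volterra b C "\<lambda>x. x" k by fact
  show ?thesis
  proof
    have "(\<lambda>p. case (case p of (x, t) \<Rightarrow> (t, x)) of (x, t) \<Rightarrow> k x t) \<in> borel_measurable (leb b \<Otimes>\<^sub>M leb b)"
      by (rule measurable_compose[OF measurable_pair_swap' k_meas])
    from measurable_ctranspose[OF this]
    show "(\<lambda>(x, t). adj_kernel k x t) \<in> borel_measurable (leb b \<Otimes>\<^sub>M leb b)"
      by (simp add: adj_kernel_def case_prod_beta)
  qed (use b k_bound k_zero in \<open>auto simp: adj_kernel_def norm_ctranspose\<close>)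
qed

lemma measurable_ident_leb:
  assumes "a \<le> b" shows "(\<lambda>x. x) \<in> measurable (leb a) (leb b)"
proof (rule measurable_restrict_space2)
  show "(\<lambda>x. x) \<in> measurable (leb a) lebesgue"
    by (rule measurable_restrict_space1) simp
qed (use assms in auto)

lemma volterra_restrict:
  assumes "volterra b C (\<lambda>x. x) k" "0 < a" "a \<le> b"
  shows "volterra a C (\<lambda>x. x) k"
proof -
  interpret volterra b C "\<lambda>x. x" k by fact
  show ?thesis
  proof
    have "(\<lambda>p. case (fst p, snd p) of (x, t) \<Rightarrow> k x t) \<in> borel_measurable (leb a \<Otimes>\<^sub>M leb a)"
      by (rule measurable_compose[OF measurable_Pair k_meas])
       (rule measurable_compose[OF _ measurable_ident_leb[OF \<open>a \<le> b\<close>]], simp)+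
    then show "(\<lambda>(x, t). k x t) \<in> borel_measurable (leb a \<Otimes>\<^sub>M leb a)" by simp
  qed (use assms k_bound k_zero in auto)
qed

lemma cinner_integral_left:
  "integrable M f \<Longrightarrow> cinner (\<integral>t. f t \<partial>M) y = (\<integral>t. cinner (f t) y \<partial>M)"
  by (rule integral_bounded_linear[OF bounded_bilinear.bounded_linear_left[OF bounded_bilinear_cinner], symmetric])

lemma cinner_integral_right:
  "integrable M f \<Longrightarrow> cinner y (\<integral>t. f t \<partial>M) = (\<integral>t. cinner y (f t) \<partial>M)"
  by (rule integral_bounded_linear[OF bounded_bilinear.bounded_linear_right[OF bounded_bilinear_cinner], symmetric])

text \<open>Fubini: the product of the kernel, \<open>f t\<close> and \<open>g x\<close> is integrable on the square
  because the kernel is bounded and \<open>f\<close>, \<open>g\<close> are integrable on the finite interval.\<close>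

lemma int_op_adjoint:
  assumes volterra_k: "volterra b C (\<lambda>x. x) k" and f: "f \<in> L2 b" and g: "g \<in> L2 b"
  shows "L2_inner b (int_op b k f) g = L2_inner b f (int_op b (adj_kernel k) g)"
proof -
  interpret K: volterra b C "\<lambda>x. x" k by fact
  interpret A: volterra b C "\<lambda>x. b - x" "adj_kernel k" by (rule volterra_adj[OF volterra_k])
  interpret PS: pair_sigma_finite "leb b" "leb b" ..
  define L where "L = (\<lambda>(x, t). cinner (k x t *v f t) (g x))"
  have fi: "integrable (leb b) f" and gi: "integrable (leb b) g" by (intro L2_integrable f g)+
  have fm: "(\<lambda>p. f (snd p)) \<in> borel_measurable (leb b \<Otimes>\<^sub>M leb b)"
    and gm: "(\<lambda>p. g (fst p)) \<in> borel_measurable (leb b \<Otimes>\<^sub>M leb b)"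
    by (rule measurable_compose[OF measurable_snd L2_measurable[OF f]]
        measurable_compose[OF measurable_fst L2_measurable[OF g]])+
  have Lm: "L \<in> borel_measurable (leb b \<Otimes>\<^sub>M leb b)"
    using measurable_bilinear[OF bounded_bilinear_cinner measurable_mv[OF K.k_meas fm] gm]
    by (simp add: L_def case_prod_beta)
  have sec: "integrable (leb b) (\<lambda>t. cinner (k x t *v f t) (g x))" if "x \<in> {0<..<b}" for x
    by (rule integrable_bounded_linear[OF bounded_bilinear.bounded_linear_left[OF bounded_bilinear_cinner]
        K.kernel_integrable[OF that fi]])
  define F1 where "F1 = (\<integral>t. norm (f t) \<partial>leb b)"
  have "integrable (leb b \<Otimes>\<^sub>M leb b) L"
  proof (rule PS.Fubini_integrable[OF Lm])
    show "integrable (leb b) (\<lambda>x. \<integral>t. norm (L (x, t)) \<partial>leb b)"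
    proof (rule Bochner_Integration.integrable_bound)
      show "integrable (leb b) (\<lambda>x. C * F1 * norm (g x))" using gi by simp
      show "(\<lambda>x. \<integral>t. norm (L (x, t)) \<partial>leb b) \<in> borel_measurable (leb b)"
        using Lm by (intro K.borel_measurable_lebesgue_integral) simp
      show "AE x in leb b. norm (\<integral>t. norm (L (x, t)) \<partial>leb b) \<le> norm (C * F1 * norm (g x))"
      proof (rule AE_I2)
        fix x assume "x \<in> space (leb b)"
        then have x: "x \<in> {0<..<b}" by simp
        have "(\<integral>t. norm (L (x, t)) \<partial>leb b) \<le> (\<integral>t. (C * norm (g x)) * norm (f t) \<partial>leb b)"
        proof (rule integral_mono)
          show "integrable (leb b) (\<lambda>t. norm (L (x, t)))" using sec[OF x] by (simp add: L_def)
          show "integrable (leb b) (\<lambda>t. (C * norm (g x)) * norm (f t))" using fi by simp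
          fix t assume "t \<in> space (leb b)"
          then have t: "t \<in> {0<..<b}" by simp
          have "norm (L (x, t)) \<le> norm (k x t *v f t) * norm (g x)" unfolding L_def by (simp add: norm_cinner_le)
          also have "\<dots> \<le> (C * norm (f t)) * norm (g x)"
            by (intro mult_right_mono norm_ge_zero order_trans[OF norm_mv mult_right_mono[OF K.k_bound[OF x t]]])
          finally show "norm (L (x, t)) \<le> (C * norm (g x)) * norm (f t)" by (simp add: mult_ac)
        qed
        also have "\<dots> = C * F1 * norm (g x)" by (simp add: F1_def mult_ac)
        finally show "norm (\<integral>t. norm (L (x, t)) \<partial>leb b) \<le> norm (C * F1 * norm (g x))" by simp
      qed
    qed
    show "AE x in leb b. integrable (leb b) (\<lambda>t. L (x, t))"
      using sec by (intro AE_I2) (simp add: L_def)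
  qed
  then have L: "integrable (leb b \<Otimes>\<^sub>M leb b) (\<lambda>(x, t). cinner (k x t *v f t) (g x))" by (simp add: L_def)
  have "L2_inner b (int_op b k f) g = (\<integral>x. \<integral>t. cinner (k x t *v f t) (g x) \<partial>leb b \<partial>leb b)"
    unfolding L2_inner_def int_op_def
    by (intro integral_leb_cong AE_I2 cinner_integral_left K.kernel_integrable fi) simp
  also have "\<dots> = (\<integral>t. \<integral>x. cinner (k x t *v f t) (g x) \<partial>leb b \<partial>leb b)"
    by (rule PS.Fubini_integral[OF L, symmetric])
  also have "\<dots> = L2_inner b f (int_op b (adj_kernel k) g)"
    unfolding L2_inner_def int_op_def
  proof (rule integral_leb_cong, rule AE_I2)
    fix t assume "t \<in> space (leb b)"
    then have "t \<in> {0<..<b}" by simp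
    from cinner_integral_right[OF A.kernel_integrable[OF this gi]]
    show "(\<integral>x. cinner (k x t *v f t) (g x) \<partial>leb b) = cinner (f t) (\<integral>x. adj_kernel k t x *v g x \<partial>leb b)"
      by (simp add: cinner_mv adj_kernel_def)
  qed
  finally show ?thesis .
qed

text \<open>Causality: for \<open>x < a\<close> a lower triangular kernel only sees the values of \<open>f\<close> on
  \<open>(0,a)\<close>.\<close>

lemma int_op_restrict:
  assumes "volterra b C (\<lambda>x. x) k" "x \<in> {0<..<a}" "a \<le> b"
  shows "int_op b k f x = int_op a k f x"
proof -
  interpret volterra b C "\<lambda>x. x" k by fact
  show ?thesis
    unfolding int_op_def integral_leb_restrict[OF \<open>a \<le> b\<close>]
    by (intro integral_leb_cong AE_I2) (use assms k_zero in auto)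
qed

lemma int_op_P_op:
  assumes "a \<le> b"
  shows "int_op b k (P_op a f) x = int_op a k f x"
  unfolding int_op_def integral_leb_restrict[OF \<open>a \<le> b\<close>]
  by (intro integral_leb_cong AE_I2) (auto simp: P_op_def)

text \<open>Anticausality: an upper triangular kernel does not spread the support of a function on \<open>(0,a)\<close>
  to the right.\<close>

lemma int_op_adj_zero:
  assumes "volterra b C (\<lambda>x. x) k" "a \<le> x" "x < b"
  shows "int_op a (adj_kernel k) f x = 0"
proof -
  interpret volterra b C "\<lambda>x. x" k by fact
  have "int_op a (adj_kernel k) f x = (\<integral>t. 0 \<partial>leb a)"
    unfolding int_op_def
    by (intro integral_leb_cong AE_I2) (use assms k_zero in \<open>auto simp: adj_kernel_def\<close>)
  then show ?thesis by simp
qed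

lemma P_op_L2:
  fixes f :: "real \<Rightarrow> complex^'n::finite"
  assumes f: "f \<in> L2 a" and "a \<le> b"
  shows "P_op a f \<in> L2 b"
proof -
  have "P_op a f \<in> borel_measurable lebesgue"
    unfolding P_op_def by (rule borel_measurable_if_I[OF L2_measurable[OF f]]) simp
  then have m: "P_op a f \<in> borel_measurable (leb b)" by (rule measurable_restrict_space1)
  have "integrable lebesgue (\<lambda>x. if x \<in> {0<..<a} then (norm (f x))\<^sup>2 else 0)"
    using L2_sq_integrable[OF f] by (subst Lebesgue_Measure.integrable_restrict_UNIV) auto
  also have "(\<lambda>x. if x \<in> {0<..<a} then (norm (f x))\<^sup>2 else 0) = (\<lambda>x. if x \<in> {0<..<b} then (norm (P_op a f x))\<^sup>2 else 0)"
    using \<open>a \<le> b\<close> by (auto simp: P_op_def)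
  finally have "integrable (leb b) (\<lambda>x. (norm (P_op a f x))\<^sup>2)"
    by (subst (asm) Lebesgue_Measure.integrable_restrict_UNIV) auto
  with m show ?thesis by (simp add: L2_def)
qed

lemma L2_restrict:
  fixes f :: "real \<Rightarrow> 'a::euclidean_space"
  assumes f: "f \<in> L2 b" and "a \<le> b"
  shows "f \<in> L2 a"
proof -
  have "f \<in> borel_measurable (leb a)"
    using measurable_compose[OF measurable_ident_leb[OF \<open>a \<le> b\<close>] L2_measurable[OF f]] .
  moreover have "integrable (leb a) (\<lambda>x. (norm (f x))\<^sup>2)"
    using set_integrable_subset[of lebesgue "{0<..<b}" "\<lambda>x. (norm (f x))\<^sup>2" "{0<..<a}"] L2_sq_integrable[OF f]
      greaterThanLessThan_subseteq_greaterThanLessThan[of 0 a 0 b] \<open>a \<le> b\<close>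
    by (simp add: set_integrable_def integrable_restrict_space)
  ultimately show ?thesis by (simp add: L2_def)
qed

lemma P_op_eq: "L2_eq a (P_op a f) f"
  by (intro L2_eqI) (simp add: P_op_def)

lemma P_op_cong: "L2_eq a f g \<Longrightarrow> a \<le> b \<Longrightarrow> L2_eq b (P_op a f) (P_op a g)"
  by (auto simp: L2_eq_def AE_restrict_space_iff P_op_def elim!: eventually_mono)

lemma L2_inner_P_op:
  fixes f g :: "real \<Rightarrow> complex^'n::finite"
  assumes "a \<le> b"
  shows "L2_inner a (P_op a f) g = L2_inner b f (P_op a g)"
proof -
  have "L2_inner a (P_op a f) g = (\<integral>x. (if x < a then cinner (P_op a f x) (g x) else 0) \<partial>leb b)"
    unfolding L2_inner_def by (rule integral_leb_restrict[OF assms])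
  also have "\<dots> = L2_inner b f (P_op a g)"
    unfolding L2_inner_def by (intro integral_leb_cong AE_I2) (auto simp: P_op_def cinner_def)
  finally show ?thesis .
qed

text \<open>The adjoint of restriction is extension by 0. \<open>P_op\<close> itself puts the value 0 outside
  \<open>(0,a)\<close>, so that it serves as its own adjoint.\<close>

lemma L2_adj_P_op:
  fixes g :: "real \<Rightarrow> complex^'n::finite"
  assumes "a \<le> b" "g \<in> L2 a"
  shows "L2_adj b a (P_op a) g \<in> L2 b" "L2_eq b (L2_adj b a (P_op a) g) (P_op a g)"
  using L2_adj_eq[of a "P_op a" b "P_op a" g] assms by (auto simp: P_op_L2 L2_inner_P_op)

section \<open>Triangular operators and the inverse of the truncated S\<close>

lemma L2_bounded_inverse_comp:
  assumes F: "L2_bounded_inverse b F F'" and G: "L2_bounded_inverse b G G'"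
    and bF: "L2_bounded_op b b F" and bG: "L2_bounded_op b b G"
  shows "L2_bounded_inverse b (\<lambda>f. F (G f)) (\<lambda>f. G' (F' f))"
  unfolding L2_bounded_inverse_def
proof (intro conjI ballI)
  note F' = L2_bounded_inverseD[OF F] and G' = L2_bounded_inverseD[OF G]
  show "L2_bounded_op b b (\<lambda>f. G' (F' f))" by (rule L2_bounded_op_comp[OF G'(1) F'(1)])
  fix f :: "real \<Rightarrow> complex^'a" assume f: "f \<in> L2 b"
  have Gf: "G f \<in> L2 b" by (rule L2_bounded_op_L2[OF bG f])
  show "L2_eq b (G' (F' (F (G f)))) f"
    by (rule L2_eq_trans[OF L2_bounded_op_cong[OF G'(1) _ Gf F'(2)[OF Gf]] G'(2)[OF f]])
      (intro F'(4) L2_bounded_op_L2[OF bF] Gf)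
  show "L2_eq b (F (G (G' (F' f)))) f"
    by (rule L2_eq_trans[OF L2_bounded_op_cong[OF bF _ _ G'(3)] F'(3)[OF f]])
      (intro F'(4) L2_bounded_op_L2[OF bG] G'(4) f)+
qed

lemma isometric_multiplication_op:
  assumes m: "v \<in> borel_measurable (leb b)" and n: "\<And>x y. x \<in> {0<..<b} \<Longrightarrow> norm (v x *v y) = norm y"
  shows "L2_bounded_op b b (\<lambda>f x. v x *v f x)"
  unfolding L2_bounded_op_def
proof (intro conjI ballI allI)
  have mm: "(\<lambda>x. v x *v f x) \<in> borel_measurable (leb b)" if "f \<in> L2 b" for f
    by (rule measurable_mv[OF m L2_measurable[OF that]])
  show "(\<lambda>x. v x *v f x) \<in> L2 b" if "f \<in> L2 b" for f
    by (rule L2_dominated[OF mm[OF that] _ that, of 0], rule AE_I2) (simp add: n)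
  have "L2_norm b (\<lambda>x. v x *v f x) = L2_norm b f" if "f \<in> L2 b" for f
    unfolding L2_norm_def
    by (intro arg_cong[where f=sqrt] integral_leb_cong AE_I2) (simp add: n)
  then show "\<exists>C. \<forall>f\<in>L2 b. L2_norm b (\<lambda>x. v x *v f x) \<le> C * L2_norm b f"
    by (intro exI[of _ 1]) simp
  show "L2_eq b (\<lambda>x. v x *v (c *s f x + d *s g x)) (\<lambda>x. c *s (v x *v f x) + d *s (v x *v g x))" for f g c d
    by (intro L2_eqI) (simp add: matrix_vector_right_distrib vector_scalar_commute)
qed

lemma scale_bounded_op: "L2_bounded_op b b (\<lambda>f x. c *s f x)"
  unfolding L2_bounded_op_def
proof (intro conjI ballI allI)
  show "(\<lambda>x. c *s f x) \<in> L2 b" if "f \<in> L2 b" for f using that by (rule L2_scale)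
  have "L2_norm b (\<lambda>x. c *s f x) = norm c * L2_norm b f" for f :: "real \<Rightarrow> complex^'a"
    unfolding L2_norm_def by (simp add: norm_vscale power_mult_distrib real_sqrt_mult)
  then show "\<exists>C. \<forall>f\<in>L2 b. L2_norm b (\<lambda>x. c *s (f x :: complex^'a)) \<le> C * L2_norm b f"
    by (intro exI[of _ "norm c"]) simp
  show "L2_eq b (\<lambda>x. c *s (d *s f x + e *s g x)) (\<lambda>x. d *s (c *s f x) + e *s (c *s g x))" for f g d e
    by (intro L2_eqI) (simp add: vector_add_ldistrib mult.commute)
qed

text \<open>\<open>tri_op\<close> is \<open>u (1 + N)\<close>, the form of \<open>V\<close>, and \<open>tri_adj\<close>
  is its adjoint \<open>(1 + N\<^sup>*) u\<^sup>*\<close>. The interval \<open>(0,b)\<close> is a parameter: the same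
  \<open>u\<close> and \<open>k\<close> give \<open>V\<close> for \<open>b = T\<close> and its truncation for \<open>b =
  l\<close>.\<close>

definition tri_op :: "real \<Rightarrow> (real \<Rightarrow> complex^'n::finite^'n) \<Rightarrow> (real \<Rightarrow> real \<Rightarrow> complex^'n^'n) \<Rightarrow>
    (real \<Rightarrow> complex^'n) \<Rightarrow> real \<Rightarrow> complex^'n"
  where "tri_op b u k f x = u x *v (f x + int_op b k f x)"

definition tri_adj :: "real \<Rightarrow> (real \<Rightarrow> complex^'n::finite^'n) \<Rightarrow> (real \<Rightarrow> real \<Rightarrow> complex^'n^'n) \<Rightarrow>
    (real \<Rightarrow> complex^'n) \<Rightarrow> real \<Rightarrow> complex^'n"
  where "tri_adj b u k g x = ctranspose (u x) *v g x + int_op b (adj_kernel k) (\<lambda>t. ctranspose (u t) *v g t) x"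

locale triangular =
  fixes T C :: real and u :: "real \<Rightarrow> complex^'n::finite^'n" and k :: "real \<Rightarrow> real \<Rightarrow> complex^'n^'n"
  assumes volterra_k: "volterra T C (\<lambda>x. x) k"
    and u_unitary: "\<And>x. x \<in> {0..T} \<Longrightarrow> unitary_matrix (u x)"
    and u_meas: "u \<in> borel_measurable (leb T)"
begin

context
  fixes b assumes b: "0 < b" "b \<le> T"
begin

lemma volterra_k_b: "volterra b C (\<lambda>x. x) k"
  by (rule volterra_restrict[OF volterra_k b])

lemmas volterra_k_adj = volterra_adj[OF volterra_k_b]

lemma u_meas_b: "u \<in> borel_measurable (leb b)"
  using measurable_compose[OF measurable_ident_leb[OF b(2)] u_meas] .

lemma u_bounded_op: "L2_bounded_op b b (\<lambda>f x. u x *v f x)"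
  and u_adj_bounded_op: "L2_bounded_op b b (\<lambda>f x. ctranspose (u x) *v f x)"
  using b u_unitary
  by (auto intro!: isometric_multiplication_op u_meas_b measurable_ctranspose norm_unitary_mv)

lemma u_inverse: "L2_bounded_inverse b (\<lambda>f x. u x *v f x) (\<lambda>f x. ctranspose (u x) *v f x)"
  and u_adj_inverse: "L2_bounded_inverse b (\<lambda>f x. ctranspose (u x) *v f x) (\<lambda>f x. u x *v f x)"
  unfolding L2_bounded_inverse_def using b u_unitary
  by (auto intro!: u_bounded_op u_adj_bounded_op L2_eqI simp: unitary_mv_cancel)

lemma tri_op_bounded: "L2_bounded_op b b (tri_op b u k)"
  using L2_bounded_op_comp[OF u_bounded_op volterra.bounded_op[OF volterra_k_b]] by (simp add: tri_op_def[abs_def])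

lemma tri_adj_bounded: "L2_bounded_op b b (tri_adj b u k)"
  using L2_bounded_op_comp[OF volterra.bounded_op[OF volterra_k_adj] u_adj_bounded_op] by (simp add: tri_adj_def[abs_def])

lemma tri_op_invertible: "\<exists>G. L2_bounded_inverse b (tri_op b u k) G"
proof -
  obtain G where "L2_bounded_inverse b (\<lambda>f x. f x + int_op b k f x) G"
    using volterra.invertible[OF volterra_k_b] by blast
  from L2_bounded_inverse_comp[OF u_inverse this u_bounded_op volterra.bounded_op[OF volterra_k_b]]
  show ?thesis by (auto simp: tri_op_def[abs_def])
qed

lemma tri_adj_invertible: "\<exists>G. L2_bounded_inverse b (tri_adj b u k) G"
proof -
  obtain G where "L2_bounded_inverse b (\<lambda>f x. f x + int_op b (adj_kernel k) f x) G"
    using volterra.invertible[OF volterra_k_adj] by blast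
  from L2_bounded_inverse_comp[OF this u_adj_inverse volterra.bounded_op[OF volterra_k_adj] u_adj_bounded_op]
  show ?thesis by (auto simp: tri_adj_def[abs_def])
qed

lemma tri_adjoint:
  assumes f: "f \<in> L2 b" and g: "g \<in> L2 b"
  shows "L2_inner b (tri_op b u k f) g = L2_inner b f (tri_adj b u k g)"
proof -
  define h where "h = (\<lambda>x. ctranspose (u x) *v g x)"
  have h: "h \<in> L2 b" unfolding h_def using L2_bounded_op_L2[OF u_adj_bounded_op g] .
  have Nf: "int_op b k f \<in> L2 b"
    using L2_diff[OF L2_bounded_op_L2[OF volterra.bounded_op[OF volterra_k_b] f] f] by simp
  have Nh: "int_op b (adj_kernel k) h \<in> L2 b"
    using L2_diff[OF L2_bounded_op_L2[OF volterra.bounded_op[OF volterra_k_adj] h] h] by simp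
  have "L2_inner b (tri_op b u k f) g = L2_inner b (\<lambda>x. f x + int_op b k f x) h"
    unfolding L2_inner_def by (simp add: tri_op_def cinner_mv h_def)
  also have "\<dots> = L2_inner b f h + L2_inner b (int_op b k f) h" by (rule L2_inner_add_left[OF f Nf h])
  also have "\<dots> = L2_inner b f h + L2_inner b f (int_op b (adj_kernel k) h)"
    by (simp add: int_op_adjoint[OF volterra_k_b f h])
  also have "\<dots> = L2_inner b f (\<lambda>x. h x + int_op b (adj_kernel k) h x)"
    by (rule L2_inner_add_right[OF h Nh f, symmetric])
  also have "\<dots> = L2_inner b f (tri_adj b u k g)" by (simp add: tri_adj_def[abs_def] h_def)
  finally show ?thesis .
qed

lemma tri_op_restrict: "x \<in> {0<..<b} \<Longrightarrow> tri_op T u k f x = tri_op b u k f x"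
  by (simp add: tri_op_def int_op_restrict[OF volterra_k _ b(2)])

text \<open>Truncation commutes with the adjoint on functions supported in \<open>(0,b)\<close>. This is the dual of
  \<open>tri_op_restrict\<close>.\<close>

lemma tri_adj_P_op: "L2_eq T (tri_adj T u k (P_op b g)) (P_op b (tri_adj b u k g))"
proof (rule L2_eqI)
  fix x assume x: "0 < x" "x < T"
  have "(\<lambda>t. ctranspose (u t) *v P_op b g t) = P_op b (\<lambda>t. ctranspose (u t) *v g t)"
    by (auto simp: P_op_def)
  then have "tri_adj T u k (P_op b g) x
     = ctranspose (u x) *v P_op b g x + int_op b (adj_kernel k) (\<lambda>t. ctranspose (u t) *v g t) x"
    by (simp add: tri_adj_def int_op_P_op[OF b(2)])
  also have "\<dots> = P_op b (tri_adj b u k g) x"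
    using x int_op_adj_zero[OF volterra_k _ x(2), of b] by (cases "x < b") (auto simp: P_op_def tri_adj_def)
  finally show "tri_adj T u k (P_op b g) x = P_op b (tri_adj b u k g) x" .
qed

end

end

context triangular
begin

context
  fixes V assumes V: "L2_bounded_op T T V" and V_tri: "\<And>f. f \<in> L2 T \<Longrightarrow> L2_eq T (V f) (tri_op T u k f)"
    and T: "0 < T"
begin

lemma V_inv: "L2_bounded_inverse T V (L2_inv T V)"
proof (rule L2_inv_spec)
  obtain G where G: "L2_bounded_inverse T (tri_op T u k) G" using tri_op_invertible[OF T order_refl] by blast
  have "L2_bounded_inverse T V G"
    by (rule L2_bounded_inverse_transfer[OF G tri_op_bounded[OF T order_refl] L2_eq_sym[OF V_tri]])
  then show "\<exists>G. L2_bounded_inverse T V G" by blast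
qed

lemma V_adj:
  assumes "g \<in> L2 T"
  shows "L2_adj T T V g \<in> L2 T" "L2_eq T (L2_adj T T V g) (tri_adj T u k g)"
proof -
  have "L2_inner T (V x) y = L2_inner T x (tri_adj T u k y)" if "x \<in> L2 T" "y \<in> L2 T" for x y
    using L2_inner_cong[OF V_tri[OF that(1)] L2_eq_refl[of T y]] tri_adjoint[OF T order_refl that] by simp
  from L2_adj_eq[of T "tri_adj T u k" T V g, OF L2_bounded_op_L2[OF tri_adj_bounded[OF T order_refl]] this assms]
  show "L2_adj T T V g \<in> L2 T" "L2_eq T (L2_adj T T V g) (tri_adj T u k g)" by blast+
qed

lemma V_adj_inv: "L2_bounded_inverse T (L2_adj T T V) (L2_inv T (L2_adj T T V))"
proof (rule L2_inv_spec)
  obtain G where G: "L2_bounded_inverse T (tri_adj T u k) G" using tri_adj_invertible[OF T order_refl] by blast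
  have "L2_bounded_inverse T (L2_adj T T V) G"
    by (rule L2_bounded_inverse_transfer[OF G tri_adj_bounded[OF T order_refl] L2_eq_sym[OF V_adj(2)]])
  then show "\<exists>G. L2_bounded_inverse T (L2_adj T T V) G" by blast
qed

context
  fixes l assumes l: "0 < l" "l \<le> T"
begin

abbreviation "Vl \<equiv> tri_op l u k"
abbreviation "Vl_adj \<equiv> tri_adj l u k"
abbreviation "Sl \<equiv> compress T l (S_op T V)"

text \<open>Follow \<open>g\<close> through the factors of \<open>S\<close>: with \<open>q = (V\<^sup>*)\<^sup>-\<^sup>1 g\<close> (\<open>g\<close> extended by 0) and \<open>r = V\<^sup>-\<^sup>1 q\<close>, the value
  of the compressed operator is the restriction of \<open>r\<close>. By uniqueness \<open>q\<close> is the extension by 0 of the solution \<open>p\<close> of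
  \<open>Vl_adj p = g\<close>, and by causality \<open>Vl r = q = p\<close> on \<open>(0,l)\<close>.\<close>

lemma Sl_right_inverse:
  assumes g: "g \<in> L2 l"
  shows "Sl g \<in> L2 l" "L2_eq l (Vl_adj (Vl (Sl g))) g"
proof -
  note Vi = L2_bounded_inverseD[OF V_inv] and Vai = L2_bounded_inverseD[OF V_adj_inv]
  define e where "e = L2_adj T l (P_op l) g"
  have e: "e \<in> L2 T" "L2_eq T e (P_op l g)" unfolding e_def using L2_adj_P_op[OF l(2) g] by auto
  define q where "q = L2_inv T (L2_adj T T V) e"
  have q: "q \<in> L2 T" unfolding q_def by (rule Vai(4)[OF e(1)])
  define r where "r = L2_inv T V q"
  have r: "r \<in> L2 T" unfolding r_def by (rule Vi(4)[OF q])
  have Sl: "Sl g = P_op l r" by (simp add: compress_def S_op_def e_def q_def r_def)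
  have rl: "r \<in> L2 l" by (rule L2_restrict[OF r l(2)])
  show Sg: "Sl g \<in> L2 l" unfolding Sl by (rule P_op_L2[OF rl order_refl])
  \<comment> \<open>solve the truncated adjoint equation; its solution extended by 0 must be \<open>q\<close>\<close>
  obtain G where G: "L2_bounded_inverse l Vl_adj G" using tri_adj_invertible[OF l] by blast
  define p where "p = G g"
  have p: "p \<in> L2 l" "L2_eq l (Vl_adj p) g" unfolding p_def using L2_bounded_inverseD[OF G] g by auto
  have Pp: "P_op l p \<in> L2 T" by (rule P_op_L2[OF p(1) l(2)])
  have "L2_eq T q (P_op l p)"
  proof (rule L2_bounded_inverse_inj[OF V_adj_inv q Pp V_adj(1)[OF q] V_adj(1)[OF Pp]])
    have "L2_eq T (L2_adj T T V q) e" unfolding q_def by (rule Vai(3)[OF e(1)])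
    also note e(2)
    also have "L2_eq T (P_op l g) (P_op l (Vl_adj p))" by (rule P_op_cong[OF L2_eq_sym[OF p(2)] l(2)])
    also have "L2_eq T (P_op l (Vl_adj p)) (tri_adj T u k (P_op l p))"
      by (rule L2_eq_sym[OF tri_adj_P_op[OF l]])
    also have "L2_eq T (tri_adj T u k (P_op l p)) (L2_adj T T V (P_op l p))"
      by (rule L2_eq_sym[OF V_adj(2)[OF Pp]])
    finally show "L2_eq T (L2_adj T T V q) (L2_adj T T V (P_op l p))" .
  qed
  then have qp: "L2_eq l q p" by (rule L2_eq_trans[OF L2_eq_mono[OF _ l(2)] P_op_eq])
  have "L2_eq l (Vl (Sl g)) (Vl r)" unfolding Sl
    by (rule L2_bounded_op_cong[OF tri_op_bounded[OF l] _ rl P_op_eq]) (rule P_op_L2[OF rl order_refl])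
  also have "L2_eq l (Vl r) (tri_op T u k r)"
    by (rule L2_eqI) (simp add: tri_op_restrict[OF l])
  also have "L2_eq l (tri_op T u k r) (V r)"
    by (rule L2_eq_mono[OF L2_eq_sym[OF V_tri[OF r]] l(2)])
  also have "L2_eq l (V r) q" unfolding r_def by (rule L2_eq_mono[OF Vi(3)[OF q] l(2)])
  also note qp
  finally have "L2_eq l (Vl_adj (Vl (Sl g))) (Vl_adj p)"
    by (rule L2_bounded_op_cong[OF tri_adj_bounded[OF l] L2_bounded_op_L2[OF tri_op_bounded[OF l] Sg] p(1)])
  then show "L2_eq l (Vl_adj (Vl (Sl g))) g" by (rule L2_eq_trans[OF _ p(2)])
qed

text \<open>One of the two identities is \<open>Sl_right_inverse\<close>; the other follows from it because
  \<open>Vl_adj\<close> and \<open>Vl\<close> are injective.\<close>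

lemma Sl_inverse: "L2_bounded_inverse l Sl (\<lambda>f. Vl_adj (Vl f))"
  unfolding L2_bounded_inverse_def
proof (intro conjI ballI)
  show bop: "L2_bounded_op l l (\<lambda>f. Vl_adj (Vl f))" by (rule L2_bounded_op_comp[OF tri_adj_bounded[OF l] tri_op_bounded[OF l]])
  obtain G where G: "L2_bounded_inverse l Vl_adj G" using tri_adj_invertible[OF l] by blast
  obtain G' where G': "L2_bounded_inverse l Vl G'" using tri_op_invertible[OF l] by blast
  note inv = L2_bounded_inverse_comp[OF G G' tri_adj_bounded[OF l] tri_op_bounded[OF l]]
  fix f :: "real \<Rightarrow> complex^'n" assume f: "f \<in> L2 l"
  show "L2_eq l (Vl_adj (Vl (Sl f))) f" by (rule Sl_right_inverse(2)[OF f])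
  have VVf: "Vl_adj (Vl f) \<in> L2 l" by (rule L2_bounded_op_L2[OF bop f])
  have S: "Sl (Vl_adj (Vl f)) \<in> L2 l" by (rule Sl_right_inverse(1)[OF VVf])
  show "L2_eq l (Sl (Vl_adj (Vl f))) f"
    by (rule L2_bounded_inverse_inj[OF inv S f L2_bounded_op_L2[OF bop S] VVf Sl_right_inverse(2)[OF VVf]])
qed

lemma Sl_inv_eq:
  assumes f: "f \<in> L2 l"
  shows "L2_inv l Sl f \<in> L2 l" "L2_eq l (L2_inv l Sl f) (Vl_adj (Vl f))"
proof -
  have inv: "L2_bounded_inverse l Sl (L2_inv l Sl)"
    by (rule L2_inv_spec) (use Sl_inverse in blast)
  show L: "L2_inv l Sl f \<in> L2 l" by (rule L2_bounded_inverseD(4)[OF inv f])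
  have "L2_eq l (L2_inv l Sl f) (Vl_adj (Vl (Sl (L2_inv l Sl f))))"
    by (rule L2_eq_sym[OF L2_bounded_inverseD(2)[OF Sl_inverse L]])
  also have "L2_eq l (Vl_adj (Vl (Sl (L2_inv l Sl f)))) (Vl_adj (Vl f))"
    by (rule L2_bounded_op_cong[OF L2_bounded_inverseD(1)[OF Sl_inverse] Sl_right_inverse(1)[OF L] f
       L2_bounded_inverseD(3)[OF inv f]])
  finally show "L2_eq l (L2_inv l Sl f) (Vl_adj (Vl f))" .
qed

end
end
end

section \<open>A Borel measurable kernel\<close>

lemma absolutely_continuous_imp_continuous_on:
  assumes "absolutely_continuous_function_on a b f"
  shows "continuous_on {a..b} f"
  unfolding continuous_on_iff
proof (intro ballI allI impI)
  fix x and e :: real assume x: "x \<in> {a..b}" and e: "0 < e"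
  then obtain d where d: "0 < d" and D: "\<And>D X. D division_of X \<Longrightarrow> X \<subseteq> {a..b} \<Longrightarrow> (\<Sum>k\<in>D. Sup k - Inf k) < d \<Longrightarrow>
      (\<Sum>k\<in>D. norm (f (Sup k) - f (Inf k))) < e"
    using assms unfolding absolutely_continuous_function_on_def by meson
  have le: "norm (f t - f s) < e" if "a \<le> s" "s \<le> t" "t \<le> b" "t - s < d" for s t
    using D[of "{{s..t}}" "{s..t}"] division_of_self[of s t] that by simp
  have "dist (f y) (f x) < e" if y: "y \<in> {a..b}" "dist y x < d" for y
  proof (cases "x \<le> y")
    case True
    then show ?thesis using le[of x y] x y by (simp add: dist_norm)
  next
    case False
    then show ?thesis using le[of y x] x y by (simp add: dist_norm norm_minus_commute)
  qed
  then show "\<exists>d>0. \<forall>y\<in>{a..b}. dist y x < d \<longrightarrow> dist (f y) (f x) < e" using d by blast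
qed

text \<open>Apply the real-valued case to each coordinate.\<close>

lemma completion_ex_borel_measurable_euclidean:
  fixes f :: "'a \<Rightarrow> 'b::euclidean_space"
  assumes f: "f \<in> borel_measurable (completion M)"
  shows "\<exists>g\<in>borel_measurable M. AE x in M. f x = g x"
proof -
  have "\<exists>g\<in>borel_measurable M. AE x in M. f x \<bullet> i = g x" for i
    by (rule completion_ex_borel_measurable_real) (use f in simp)
  then obtain g where g: "\<And>i. g i \<in> borel_measurable M" "\<And>i. AE x in M. f x \<bullet> i = g i x" by metis
  have "AE x in M. \<forall>i\<in>Basis. f x \<bullet> i = g i x" by (rule AE_finite_allI) (auto intro: g)
  then have ae: "AE x in M. f x = (\<Sum>i\<in>Basis. g i x *\<^sub>R i)"
    by eventually_elim (metis (no_types, lifting) euclidean_representation sum.cong)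
  show ?thesis by (rule bexI[of _ "\<lambda>x. \<Sum>i\<in>Basis. g i x *\<^sub>R i"]) (use ae g(1) in simp_all)
qed

lemma measurable_ident_leb_borel: "(\<lambda>x. x) \<in> measurable (leb b) borel"
  by (rule measurable_leb_borel) simp

text \<open>The given kernel \<open>v\<close> is Lebesgue measurable on a triangle in the plane, so it need not be measurable for the product
  of the Lebesgue sigma-algebras on the two axes, as Fubini's theorem requires. It agrees almost everywhere with a Borel function,
  which is truncated to keep the bound and the triangular support. For almost every \<open>x\<close> the two kernels then agree for
  almost every \<open>t\<close>, which is all that enters \<open>V f\<close> up to \<open>L2_eq\<close>.\<close>

lemma triangular_form_kernel:
  fixes V :: "(real \<Rightarrow> complex^'n::finite) \<Rightarrow> (real \<Rightarrow> complex^'n)"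
  assumes T: "0 < T" and V: "triangular_form T V"
  obtains C u k where "triangular T C u k" "\<And>f. f \<in> L2 T \<Longrightarrow> L2_eq T (V f) (tri_op T u k f)"
proof -
  define \<Delta> :: "(real \<times> real) set" where "\<Delta> = {(x, t). 0 \<le> t \<and> t \<le> x \<and> x \<le> T}"
  from V obtain u :: "real \<Rightarrow> complex^'n^'n" and v :: "real \<Rightarrow> real \<Rightarrow> complex^'n^'n" where
    u: "\<And>x. x \<in> {0..T} \<Longrightarrow> unitary_matrix (u x)" "absolutely_continuous_function_on 0 T u" and
    vm: "(\<lambda>(x, t). v x t) \<in> borel_measurable (lebesgue_on \<Delta>)" and
    vb: "bdd_above {norm (v x t) | x t. 0 \<le> t \<and> t \<le> x \<and> x \<le> T}" and
    Vf: "\<And>f. f \<in> L2 T \<Longrightarrow> L2_eq T (V f) (\<lambda>x. u x *v (f x + (\<integral>t. v x t *v f t \<partial>leb x)))"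
    unfolding triangular_form_def \<Delta>_def by blast
  from vb obtain C where C: "\<And>x t. 0 \<le> t \<Longrightarrow> t \<le> x \<Longrightarrow> x \<le> T \<Longrightarrow> norm (v x t) \<le> C"
    unfolding bdd_above_def by blast
  have C0: "0 \<le> C" using C[of 0 0] T norm_ge_zero[of "v 0 0"] by linarith
  have "closed \<Delta>"
    unfolding \<Delta>_def case_prod_beta
    by (intro closed_Collect_conj closed_Collect_le continuous_intros)
  then have "\<Delta> \<in> sets lebesgue" by auto
  from completion_ex_borel_measurable_euclidean[OF borel_measurable_if_I[OF vm this]] obtain v1 where
    v1m: "v1 \<in> borel_measurable (lborel :: (real \<times> real) measure)" and
    v1: "AE p in lborel. (if p \<in> \<Delta> then case p of (x, t) \<Rightarrow> v x t else 0) = v1 p"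
    by (elim bexE)
  have v1m': "v1 \<in> borel_measurable (borel \<Otimes>\<^sub>M borel)" using v1m by (simp add: borel_prod)
  from v1[folded lborel_prod] have ae: "AE x in lborel. AE t in lborel.
      (if (x, t) \<in> \<Delta> then v x t else 0) = v1 (x, t)"
    by (auto dest: lborel_pair.AE_pair)
  \<comment> \<open>the values for \<open>t \<ge> x\<close> do not enter \<open>V f\<close>; setting them to 0 makes the kernel triangular\<close>
  define k where "k x t = (if t < x \<and> norm (v1 (x, t)) \<le> C then v1 (x, t) else 0)" for x t
  have km: "(\<lambda>(x, t). k x t) \<in> borel_measurable (borel \<Otimes>\<^sub>M borel)"
    unfolding k_def case_prod_beta prod.collapse using v1m' by measurable
  have tri: "triangular T C u k"
  proof
    have "(\<lambda>p. case (fst p, snd p) of (x, t) \<Rightarrow> k x t) \<in> borel_measurable (leb T \<Otimes>\<^sub>M leb T)"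
      by (rule measurable_compose[OF measurable_Pair[OF measurable_compose[OF measurable_fst measurable_ident_leb_borel]
        measurable_compose[OF measurable_snd measurable_ident_leb_borel]] km])
    then show "(\<lambda>(x, t). k x t) \<in> borel_measurable (leb T \<Otimes>\<^sub>M leb T)" by simp
    have "continuous_on {0<..<T} u"
      by (rule continuous_on_subset[OF absolutely_continuous_imp_continuous_on[OF u(2)]]) auto
    then show "u \<in> borel_measurable (leb T)"
      by (rule continuous_imp_measurable_on_sets_lebesgue) simp
  qed (use T u C0 in \<open>auto simp: k_def\<close>)
  have "AE x in leb T. \<forall>f. (\<integral>t. v x t *v f t \<partial>leb x) = int_op T k f x"
    unfolding AE_restrict_space_iff[of "{0<..<T}" lebesgue, simplified]
  proof -
    show "AE x in lebesgue. 0 < x \<and> x < T \<longrightarrow> (\<forall>f. (\<integral>t. v x t *v f t \<partial>leb x) = int_op T k f x)"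
      using AE_completion[OF ae]
    proof eventually_elim
      case (elim x)
      show ?case
      proof (intro impI allI)
        fix f assume x: "0 < x \<and> x < T"
        have "AE t in lebesgue. t \<in> {0<..<x} \<longrightarrow> v x t = k x t"
          using AE_completion[OF elim]
        proof eventually_elim
          case (elim t)
          show ?case
          proof
            assume t: "t \<in> {0<..<x}"
            then have "norm (v x t) \<le> C" using x by (intro C) auto
            then show "v x t = k x t" using elim t x by (simp add: k_def \<Delta>_def)
          qed
        qed
        then have "AE t in leb x. v x t *v f t = k x t *v f t"
          by (subst AE_restrict_space_iff) (auto elim: eventually_mono)
        then have "(\<integral>t. v x t *v f t \<partial>leb x) = (\<integral>t. k x t *v f t \<partial>leb x)" by (rule integral_leb_cong)
        also have "\<dots> = int_op T k f x"
          unfolding int_op_def using x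
          by (subst integral_leb_restrict[of x T]) (auto intro!: integral_leb_cong AE_I2 simp: k_def)
        finally show "(\<integral>t. v x t *v f t \<partial>leb x) = int_op T k f x" .
      qed
    qed
  qed
  then have eq: "L2_eq T (\<lambda>x. u x *v (f x + (\<integral>t. v x t *v f t \<partial>leb x))) (tri_op T u k f)" for f
    unfolding L2_eq_def tri_op_def by eventually_elim simp
  show ?thesis by (rule that[OF tri L2_eq_trans[OF Vf eq]])
qed

section \<open>The operators A and K, and the adjoint of Pi\<close>

lemma mat_mv: "mat c *v (x :: complex^'n::finite) = c *s x"
  by (simp add: matrix_vector_mult_def mat_def vec_eq_iff if_distrib[of "\<lambda>a. a * _"] cong: if_cong)

lemma bounded_linear_mat: "bounded_linear (mat :: complex \<Rightarrow> complex^'n::finite^'n)"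
  unfolding linear_conv_bounded_linear[symmetric]
  by (auto intro!: linearI simp: mat_def vec_eq_iff)

lemma volterra_scaled:
  fixes k :: "real \<Rightarrow> real \<Rightarrow> complex^'n::finite^'n"
  assumes "volterra b C w k"
  obtains C' where "volterra b C' w (\<lambda>x t. mat d ** k x t)"
    "\<And>f x. f \<in> L2 b \<Longrightarrow> x \<in> {0<..<b} \<Longrightarrow> int_op b (\<lambda>x t. mat d ** k x t) f x = d *s int_op b k f x"
proof -
  interpret volterra b C w k by fact
  have bl: "bounded_linear (\<lambda>M :: complex^'n^'n. mat d ** M)"
    by (rule bounded_bilinear.bounded_linear_right[OF bounded_bilinear_mm])
  obtain K where K: "0 \<le> K" "\<And>M :: complex^'n^'n. norm (mat d ** M) \<le> norm M * K"
    using bounded_linear.nonneg_bounded[OF bl] by blast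
  show ?thesis
  proof (rule that[of "C * K"])
    show "volterra b (C * K) w (\<lambda>x t. mat d ** k x t)"
    proof
      have "(\<lambda>p. mat d ** (case p of (x, t) \<Rightarrow> k x t)) \<in> borel_measurable (leb b \<Otimes>\<^sub>M leb b)"
        by (rule measurable_compose[OF k_meas borel_measurable_continuous_onI[OF linear_continuous_on[OF bl]]])
      then show "(\<lambda>(x, t). mat d ** k x t) \<in> borel_measurable (leb b \<Otimes>\<^sub>M leb b)"
        by (simp add: case_prod_beta)
      show "norm (mat d ** k x t) \<le> C * K" if "x \<in> {0<..<b}" "t \<in> {0<..<b}" for x t
        by (rule order_trans[OF K(2) mult_right_mono[OF k_bound[OF that] K(1)]])
      show "mat d ** k x t = 0" if "x \<in> {0<..<b}" "t \<in> {0<..<b}" "\<not> w t < w x" for x t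
        by (simp add: k_zero[OF that] linear_0[OF bounded_linear.linear[OF bl]])
    qed (use b w in auto)
    fix f :: "real \<Rightarrow> complex^'n" and x assume f: "f \<in> L2 b" and x: "x \<in> {0<..<b}"
    show "int_op b (\<lambda>x t. mat d ** k x t) f x = d *s int_op b k f x"
      unfolding int_op_def matrix_vector_mul_assoc[symmetric] mat_mv
      by (rule integral_bounded_linear[OF bounded_linear_vscale kernel_integrable[OF x L2_integrable[OF f]]])
  qed
qed

text \<open>Scaling keeps a Volterra kernel bounded and triangular, so the Neumann series converges for every
  \<open>d\<close>. The cases of interest are \<open>d = - 1 / c\<close> for \<open>A - c\<close> and \<open>d = -
  z\<close> for \<open>1 - z K\<close>.\<close>

lemma volterra_scaled_invertible:
  fixes k :: "real \<Rightarrow> real \<Rightarrow> complex^'n::finite^'n"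
  assumes "volterra b C w k"
  shows "L2_bounded_op b b (\<lambda>f x. f x + d *s int_op b k f x)"
    "\<exists>G. L2_bounded_inverse b (\<lambda>f x. f x + d *s int_op b k f x) G"
proof -
  obtain C' where v: "volterra b C' w (\<lambda>x t. mat d ** k x t)"
    and eq: "\<And>f x. f \<in> L2 b \<Longrightarrow> x \<in> {0<..<b} \<Longrightarrow> int_op b (\<lambda>x t. mat d ** k x t) f x = d *s int_op b k f x"
    using volterra_scaled[OF assms] by metis
  have eq': "L2_eq b (\<lambda>x. f x + int_op b (\<lambda>x t. mat d ** k x t) f x) (\<lambda>x. f x + d *s int_op b k f x)"
    if "f \<in> L2 b" for f
    by (rule L2_eqI) (simp add: eq[OF that])
  show bop: "L2_bounded_op b b (\<lambda>f x. f x + d *s int_op b k f x)"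
    by (rule L2_bounded_op_transfer[OF volterra.bounded_op[OF v] eq'])
  obtain G where "L2_bounded_inverse b (\<lambda>f x. f x + int_op b (\<lambda>x t. mat d ** k x t) f x) G"
    using volterra.invertible[OF v] by blast
  from L2_bounded_inverse_transfer[OF this volterra.bounded_op[OF v] eq']
  show "\<exists>G. L2_bounded_inverse b (\<lambda>f x. f x + d *s int_op b k f x) G" by blast
qed

definition A_kernel :: "real \<Rightarrow> real \<Rightarrow> complex^'n::finite^'n"
  where "A_kernel x t = mat (if t < x then of_real (t - x) else 0)"

lemma volterra_A:
  assumes b: "0 < b"
  obtains C where "volterra b C (\<lambda>x. x) (A_kernel :: real \<Rightarrow> real \<Rightarrow> complex^'n::finite^'n)"
proof -
  obtain K where K: "0 \<le> K" "\<And>c. norm (mat c :: complex^'n^'n) \<le> norm c * K"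
    using bounded_linear.nonneg_bounded[OF bounded_linear_mat] by blast
  have id: "(\<lambda>p. p) \<in> measurable (leb b \<Otimes>\<^sub>M leb b) (borel \<Otimes>\<^sub>M borel)"
    using measurable_Pair[OF measurable_compose[OF measurable_fst measurable_ident_leb_borel]
        measurable_compose[OF measurable_snd measurable_ident_leb_borel]] by simp
  have "(\<lambda>p. if snd p < fst p then complex_of_real (snd p - fst p) else 0) \<in> borel_measurable (borel \<Otimes>\<^sub>M borel)"
    by measurable
  note m = measurable_compose[OF id this]
  have "volterra b (b * K) (\<lambda>x. x) (A_kernel :: real \<Rightarrow> real \<Rightarrow> complex^'n^'n)"
  proof
    show "(\<lambda>(x, t). A_kernel x t :: complex^'n^'n) \<in> borel_measurable (leb b \<Otimes>\<^sub>M leb b)"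
      unfolding A_kernel_def case_prod_beta
      by (rule measurable_compose[OF m borel_measurable_continuous_onI[OF linear_continuous_on[OF bounded_linear_mat]]])
    show "norm (A_kernel x t :: complex^'n^'n) \<le> b * K" if "x \<in> {0<..<b}" "t \<in> {0<..<b}" for x t
      unfolding A_kernel_def
      by (rule order_trans[OF K(2) mult_right_mono[OF _ K(1)]])
        (use that in \<open>auto simp del: of_real_diff simp: norm_of_real\<close>)
  qed (use b in \<open>auto simp: A_kernel_def mat_def vec_eq_iff\<close>)
  then show ?thesis by (rule that)
qed

lemma scaleR_eq_mat_mv: "r *\<^sub>R (y :: complex^'n::finite) = mat (of_real r) *v y"
  unfolding mat_mv vec_eq_iff by (simp add: scaleR_conv_of_real[where 'a=complex])

lemma A_op_eq: "x \<le> b \<Longrightarrow> A_op f x = int_op b A_kernel f x"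
  unfolding A_op_def int_op_def integral_leb_restrict[of x b]
  by (intro integral_leb_cong AE_I2) (auto simp: A_kernel_def scaleR_eq_mat_mv mat_mv)

lemma A_op_L2:
  assumes "0 < b" "f \<in> L2 b"
  shows "A_op f \<in> L2 b"
proof -
  obtain C where C: "volterra b C (\<lambda>x. x) (A_kernel :: real \<Rightarrow> real \<Rightarrow> complex^'a^'a)" using volterra_A[OF assms(1)] .
  have "(\<lambda>x. (f x + int_op b A_kernel f x) - f x) \<in> L2 b"
    by (rule L2_diff[OF L2_bounded_op_L2[OF volterra.bounded_op[OF C] assms(2)] assms(2)])
  then have "int_op b A_kernel f \<in> L2 b" by simp
  then show ?thesis by (rule L2_eq_L2[rotated]) (intro L2_eqI, simp add: A_op_eq[of _ b])
qed

lemma A_op_cong: "L2_eq b f g \<Longrightarrow> L2_eq b (A_op f) (A_op g)"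
  by (rule L2_eqI) (simp add: A_op_eq[of _ b] int_op_cong)

lemma compress_A:
  assumes l: "l \<le> T" and f: "f \<in> L2 l" and x: "x \<in> {0<..<l}"
  shows "compress T l A_op f x = A_op f x"
proof -
  have eq: "L2_eq l (L2_adj T l (P_op l) f) f"
    by (rule L2_eq_trans[OF L2_eq_mono[OF L2_adj_P_op(2)[OF l f] l] P_op_eq])
  show ?thesis using x int_op_cong[OF eq]
    by (simp add: compress_def P_op_def A_op_eq[of x l])
qed

text \<open>\<open>A - c\<close> is \<open>- c\<close> times \<open>1 - A / c\<close>, and \<open>A\<close> is a
  Volterra operator.\<close>

lemma A_resolvent:
  assumes l: "0 < l" "l \<le> T" and c: "c \<noteq> 0"
  shows "\<exists>G. L2_bounded_inverse l (\<lambda>f x. compress T l A_op f x - c *s (f x :: complex^'n::finite)) G"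
proof -
  obtain C where C: "volterra l C (\<lambda>x. x) (A_kernel :: real \<Rightarrow> real \<Rightarrow> complex^'n^'n)" using volterra_A[OF l(1)] .
  let ?F = "\<lambda>(f :: real \<Rightarrow> complex^'n) x. f x + (- 1 / c) *s int_op l A_kernel f x"
  obtain G where G: "L2_bounded_inverse l ?F G" using volterra_scaled_invertible(2)[OF C] by blast
  have s: "L2_bounded_inverse l (\<lambda>(f :: real \<Rightarrow> complex^'n) x. (- c) *s f x) (\<lambda>f x. (- 1 / c) *s f x)"
    unfolding L2_bounded_inverse_def
    by (intro conjI ballI scale_bounded_op L2_eqI) (use c in \<open>simp_all add: vector_smult_assoc\<close>)
  have R: "L2_eq l (\<lambda>x. (- c) *s ?F f x) (\<lambda>x. compress T l A_op f x - c *s f x)" if "f \<in> L2 l" for f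
  proof (rule L2_eqI)
    fix x assume "0 < x" "x < l"
    then have "compress T l A_op f x = int_op l A_kernel f x"
      using compress_A[OF l(2) that, of x] A_op_eq[of x l f] by simp
    then show "(- c) *s ?F f x = compress T l A_op f x - c *s f x"
      using c by (simp add: vec_eq_iff field_simps)
  qed
  have bF: "L2_bounded_op l l ?F" by (rule volterra_scaled_invertible(1)[OF C])
  have inv: "L2_bounded_inverse l (\<lambda>f x. (- c) *s ?F f x) (\<lambda>f. G (\<lambda>x. (- 1 / c) *s f x))"
    by (rule L2_bounded_inverse_comp[OF s G scale_bounded_op bF])
  have "L2_bounded_inverse l (\<lambda>f x. compress T l A_op f x - c *s f x) (\<lambda>f. G (\<lambda>x. (- 1 / c) *s f x))"
    by (rule L2_bounded_inverse_transfer[OF inv L2_bounded_op_comp[OF scale_bounded_op bF] R])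
  then show ?thesis by blast
qed

lemma cinner_axis: "cinner (axis i 1) y = cnj (y $ i)"
  by (simp add: cinner_def axis_def if_distrib[of "\<lambda>a. a * _"] cong: if_cong)

text \<open>The adjoint of a map from \<open>\<complex>\<^sup>m\<close> is the vector of inner products with the images
  of the unit vectors, since such a map is determined by these images.\<close>

lemma vec_L2_adj_nth:
  fixes P :: "complex^'m::finite \<Rightarrow> real \<Rightarrow> complex^'n::finite"
  assumes P: "\<And>i. P (axis i 1) \<in> L2 b" and lin: "\<And>h x. P h x = (\<Sum>i\<in>UNIV. h $ i *s P (axis i 1) x)"
    and y: "y \<in> L2 b"
  shows "vec_L2_adj b P y $ i = L2_inner b y (P (axis i 1))"
proof -
  have c: "cnj (L2_inner b f g) = L2_inner b g f" for f g :: "real \<Rightarrow> complex^'n"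
    unfolding L2_inner_def by (subst cinner_commute) simp
  have adj: "L2_inner b (P h) y = cinner h (\<chi> i. L2_inner b y (P (axis i 1)))" if y: "y \<in> L2 b" for h y
  proof -
    have "cinner (P h x) (y x) = (\<Sum>i\<in>UNIV. h $ i * cinner (P (axis i 1) x) (y x))" for x
      by (subst lin) (simp add: cinner_def sum_distrib_left sum_distrib_right mult.assoc, rule sum.swap)
    then have "L2_inner b (P h) y = (\<Sum>i\<in>UNIV. h $ i * L2_inner b (P (axis i 1)) y)"
      unfolding L2_inner_def using integrable_cinner[OF P y]
      by (simp add: Bochner_Integration.integral_sum)
    also have "\<dots> = cinner h (\<chi> i. L2_inner b y (P (axis i 1)))"
      by (simp add: cinner_def c)
    finally show ?thesis .
  qed
  have "L2_inner b (P (axis i 1)) y = cinner (axis i 1) (vec_L2_adj b P y)"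
    unfolding vec_L2_adj_def
    by (rule adj_op_spec(2)[where G="\<lambda>y. \<chi> i. L2_inner b y (P (axis i 1))"]) (use adj y in auto)
  then show ?thesis using c[of "P (axis i 1)" y] by (simp add: cinner_axis)
qed

definition K_kernel :: "(real \<Rightarrow> complex^('p::finite + 'p)^'p) \<Rightarrow> real \<Rightarrow> real \<Rightarrow> complex^'p^'p"
  where "K_kernel \<beta> x t = (if t < x then (mat \<i> ** \<beta> x ** jmat) ** ctranspose (\<beta> t) else 0)"

lemma continuous_on_mm:
  fixes f :: "'a::topological_space \<Rightarrow> complex^'n::finite^'m::finite" and g :: "'a \<Rightarrow> complex^'k::finite^'n"
  shows "continuous_on S f \<Longrightarrow> continuous_on S g \<Longrightarrow> continuous_on S (\<lambda>x. f x ** g x)"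
  by (rule bounded_bilinear.continuous_on[OF bounded_bilinear_mm])

lemma continuous_on_mv:
  fixes f :: "'a::topological_space \<Rightarrow> complex^'n::finite^'m::finite" and g :: "'a \<Rightarrow> complex^'n"
  shows "continuous_on S f \<Longrightarrow> continuous_on S g \<Longrightarrow> continuous_on S (\<lambda>x. f x *v g x)"
  by (rule bounded_bilinear.continuous_on[OF bounded_bilinear_mv])

lemma continuous_on_ctranspose:
  fixes f :: "'a::topological_space \<Rightarrow> complex^'n::finite^'m::finite"
  shows "continuous_on S f \<Longrightarrow> continuous_on S (\<lambda>x. ctranspose (f x))"
  by (rule bounded_linear.continuous_on[OF bounded_linear_ctranspose])

lemma continuous_on_leb_measurable:
  fixes f :: "real \<Rightarrow> 'a::euclidean_space"
  assumes "continuous_on {0..T} f"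
  shows "f \<in> borel_measurable (leb T)"
  by (rule continuous_imp_measurable_on_sets_lebesgue[OF continuous_on_subset[OF assms]]) auto

lemma continuous_on_leb_bounded:
  fixes f :: "real \<Rightarrow> 'a::euclidean_space"
  assumes "continuous_on {0..T} f"
  shows "\<exists>B\<ge>0. \<forall>x\<in>{0<..<T}. norm (f x) \<le> B"
proof -
  obtain B where "B > 0" "\<forall>y\<in>f ` {0..T}. norm y \<le> B"
    using compact_imp_bounded[OF compact_continuous_image[OF assms compact_Icc]] bounded_pos by blast
  then show ?thesis by (intro exI[of _ B]) auto
qed

lemma continuous_on_L2:
  fixes f :: "real \<Rightarrow> 'a::euclidean_space"
  assumes "continuous_on {0..T} f"
  shows "f \<in> L2 T"
proof -
  obtain B where "\<And>x. x \<in> {0<..<T} \<Longrightarrow> norm (f x) \<le> B" using continuous_on_leb_bounded[OF assms] by blast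
  then show ?thesis by (rule L2_bounded[OF continuous_on_leb_measurable[OF assms]])
qed

lemma volterra_K:
  fixes \<beta> :: "real \<Rightarrow> complex^('p::finite + 'p)^'p"
  assumes T: "0 < T" and \<beta>: "continuous_on {0..T} \<beta>"
  obtains C where "volterra T C (\<lambda>x. x) (K_kernel \<beta>)"
proof -
  define M where "M x = mat \<i> ** \<beta> x ** jmat" for x
  have M: "continuous_on {0..T} M" unfolding M_def[abs_def]
    by (rule continuous_on_mm[OF continuous_on_mm[OF continuous_on_const \<beta>] continuous_on_const])
  note \<beta>t = continuous_on_ctranspose[OF \<beta>]
  obtain B1 where B1: "0 \<le> B1" "\<And>x. x \<in> {0<..<T} \<Longrightarrow> norm (M x) \<le> B1" using continuous_on_leb_bounded[OF M] by blast
  obtain B2 where B2: "0 \<le> B2" "\<And>x. x \<in> {0<..<T} \<Longrightarrow> norm (ctranspose (\<beta> x)) \<le> B2"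
    using continuous_on_leb_bounded[OF \<beta>t] by blast
  obtain K where K: "0 \<le> K" "\<And>A B. norm ((A :: complex^('p+'p)^'p) ** (B :: complex^'p^('p + 'p))) \<le> norm A * norm B * K"
    using bounded_bilinear.nonneg_bounded[OF bounded_bilinear_mm] by blast
  have le: "norm (M x ** ctranspose (\<beta> t)) \<le> B1 * B2 * K" if "x \<in> {0<..<T}" "t \<in> {0<..<T}" for x t
    by (rule order_trans[OF K(2) mult_right_mono[OF mult_mono[OF B1(2)[OF that(1)] B2(2)[OF that(2)] B1(1) norm_ge_zero] K(1)]])
  have "volterra T (B1 * B2 * K) (\<lambda>x. x) (K_kernel \<beta>)"
  proof
    have m: "(\<lambda>p. M (fst p) ** ctranspose (\<beta> (snd p))) \<in> borel_measurable (leb T \<Otimes>\<^sub>M leb T)"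
      by (rule measurable_bilinear[OF bounded_bilinear_mm
          measurable_compose[OF measurable_fst continuous_on_leb_measurable[OF M]]
          measurable_compose[OF measurable_snd continuous_on_leb_measurable[OF \<beta>t]]])
    have "(\<lambda>p. p) \<in> measurable (leb T \<Otimes>\<^sub>M leb T) (borel \<Otimes>\<^sub>M borel)"
      using measurable_Pair[OF measurable_compose[OF measurable_fst measurable_ident_leb_borel]
        measurable_compose[OF measurable_snd measurable_ident_leb_borel]] by simp
    then have "Measurable.pred (leb T \<Otimes>\<^sub>M leb T) (\<lambda>p. snd p < fst p)"
      by (rule measurable_compose) measurable
    then have "(\<lambda>p. if snd p < fst p then M (fst p) ** ctranspose (\<beta> (snd p)) else 0) \<in> borel_measurable (leb T \<Otimes>\<^sub>M leb T)"
      by (intro measurable_If m) (auto simp: pred_def)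
    then show "(\<lambda>(x, t). K_kernel \<beta> x t) \<in> borel_measurable (leb T \<Otimes>\<^sub>M leb T)"
      unfolding K_kernel_def M_def case_prod_unfold .
    show "norm (K_kernel \<beta> x t) \<le> B1 * B2 * K" if "x \<in> {0<..<T}" "t \<in> {0<..<T}" for x t
      using le[OF that] B1(1) B2(1) K(1) by (simp add: K_kernel_def M_def)
  qed (use T in \<open>auto simp: K_kernel_def\<close>)
  then show ?thesis by (rule that)
qed

lemma integrable_mv_continuous:
  assumes M: "continuous_on {0..T} M" and f: "f \<in> L2 T"
  shows "integrable (leb T) (\<lambda>t. (M t :: complex^'n::finite^'m::finite) *v f t)"
proof -
  obtain B where B: "0 \<le> B" "\<And>x. x \<in> {0<..<T} \<Longrightarrow> norm (M x) \<le> B" using continuous_on_leb_bounded[OF M] by blast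
  show ?thesis
  proof (rule Bochner_Integration.integrable_bound)
  show "integrable (leb T) (\<lambda>t. B * norm (f t))" using L2_integrable[OF f] by simp
  show "(\<lambda>t. M t *v f t) \<in> borel_measurable (leb T)"
    by (rule measurable_mv[OF continuous_on_leb_measurable[OF M] L2_measurable[OF f]])
  show "AE t in leb T. norm (M t *v f t) \<le> norm (B * norm (f t))"
  proof (rule AE_I2)
    fix t assume "t \<in> space (leb T)"
    then show "norm (M t *v f t) \<le> norm (B * norm (f t))"
      using B order_trans[OF norm_mv mult_right_mono[OF B(2)[of t] norm_ge_zero]] by simp
  qed
qed
qed

lemma K_op_eq:
  assumes \<beta>: "continuous_on {0..T} \<beta>" and f: "f \<in> L2 T" and x: "x \<in> {0<..<T}"
  shows "K_op \<beta> f x = int_op T (K_kernel \<beta>) f x"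
proof -
  have "continuous_on {0..x} \<beta>" by (rule continuous_on_subset[OF \<beta>]) (use x in auto)
  from integrable_mv_continuous[OF continuous_on_ctranspose[OF this] L2_restrict[OF f]]
  have i: "integrable (leb x) (\<lambda>t. ctranspose (\<beta> t) *v f t)" using x by simp
  have "K_op \<beta> f x = (\<integral>t. (mat \<i> ** \<beta> x ** jmat) *v (ctranspose (\<beta> t) *v f t) \<partial>leb x)"
    unfolding K_op_def
    by (rule integral_bounded_linear[OF bounded_bilinear.bounded_linear_right[OF bounded_bilinear_mv] i, symmetric])
  also have "\<dots> = int_op T (K_kernel \<beta>) f x"
    unfolding int_op_def using x
    by (subst integral_leb_restrict[of x T])
      (auto intro!: integral_leb_cong AE_I2 simp: K_kernel_def matrix_vector_mul_assoc)
  finally show ?thesis .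
qed

section \<open>The canonical system and the transfer function\<close>

lemma mv_axis: "(M :: complex^'n::finite^'m::finite) *v axis i 1 = column i M"
  by (simp add: matrix_vector_mult_def axis_def column_def vec_eq_iff if_distrib[of "\<lambda>a. _ * a"] cong: if_cong)

lemma matrix_eqI_axis:
  fixes A B :: "complex^'n::finite^'m::finite"
  assumes "\<And>i. A *v axis i 1 = B *v axis i 1"
  shows "A = B"
  using assms by (simp add: mv_axis column_def vec_eq_iff)

lemma matrix_mv_axis: "matrix (f :: complex^'n::finite \<Rightarrow> complex^'m::finite) *v axis i 1 = f (axis i 1)"
  by (simp add: mv_axis column_def matrix_def vec_eq_iff)

text \<open>The fundamental theorem of calculus, with the constant matrices taken out of the integral.\<close>

lemma canonical_integral:
  fixes \<beta> :: "real \<Rightarrow> complex^('p::finite + 'p)^'p" and W :: "real \<Rightarrow> complex^('p + 'p)^('p + 'p)"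
  assumes \<beta>: "continuous_on {0..x} \<beta>" and x: "0 \<le> x" and W0: "W 0 = mat 1"
    and W: "\<And>t. t \<in> {0..x} \<Longrightarrow> (W has_vector_derivative mat (\<i> * z) ** jmat ** Hamiltonian \<beta> t ** W t) (at t within {0..x})"
  shows "W x *v h - h = mat (\<i> * z) *v (jmat *v (\<integral>t. ctranspose (\<beta> t) *v (\<beta> t *v (W t *v h)) \<partial>leb x))"
proof -
  let ?g = "\<lambda>t. ctranspose (\<beta> t) *v (\<beta> t *v (W t *v h))"
  let ?L = "\<lambda>y. mat (\<i> * z) *v (jmat *v y) :: complex^('p + 'p)"
  have blv: "bounded_linear (\<lambda>M :: complex^('p + 'p)^('p + 'p). M *v h)"
    by (rule bounded_bilinear.bounded_linear_left[OF bounded_bilinear_mv])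
  have Wc: "continuous_on {0..x} W"
    using W has_vector_derivative_continuous continuous_on_eq_continuous_within by blast
  have g: "continuous_on {0..x} ?g"
    by (rule continuous_on_mv[OF continuous_on_ctranspose[OF \<beta>] continuous_on_mv[OF \<beta> continuous_on_mv[OF Wc continuous_on_const]]])
  have L: "bounded_linear ?L"
    by (rule bounded_linear_compose[OF bounded_bilinear.bounded_linear_right[OF bounded_bilinear_mv]
      bounded_bilinear.bounded_linear_right[OF bounded_bilinear_mv]])
  have "(\<integral>t. ?L (?g t) \<partial>leb x) = W x *v h - W 0 *v h"
  proof (rule integral_leb_FTC[OF x])
    show "((\<lambda>t. W t *v h) has_vector_derivative ?L (?g t)) (at t within {0..x})" if "t \<in> {0..x}" for t
      using bounded_linear.has_vector_derivative[OF blv W[OF that]]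
      by (simp add: Hamiltonian_def matrix_vector_mul_assoc matrix_mul_assoc)
    show "continuous_on {0..x} (\<lambda>t. ?L (?g t))"
      by (rule continuous_on_mv[OF continuous_on_const continuous_on_mv[OF continuous_on_const g]])
  qed
  moreover have "(\<integral>t. ?L (?g t) \<partial>leb x) = ?L (\<integral>t. ?g t \<partial>leb x)"
    by (rule integral_bounded_linear[OF L L2_integrable[OF continuous_on_L2[OF g]]])
  ultimately show ?thesis by (simp add: W0)
qed

theorem theorem2p2:
  fixes I :: "real set" and T :: real
    and \<beta> \<beta>' \<beta>'' :: "real \<Rightarrow> complex^('p::finite + 'p)^'p"
    and W :: "real \<Rightarrow> complex \<Rightarrow> complex^('p + 'p)^('p + 'p)"
    and V :: "(real \<Rightarrow> complex^'p) \<Rightarrow> (real \<Rightarrow> complex^'p)"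
    and l :: real and z :: complex
  assumes "0 < T"
    and "I = {0..T} \<and> (\<forall>i k. (\<lambda>x. \<beta>'' x $ i $ k) \<in> L2 T) \<or>
         I = {0..} \<and> (\<forall>b>0. \<forall>i k. (\<lambda>x. \<beta>'' x $ i $ k) \<in> L2 b)"
    and "\<And>x. x \<in> I \<Longrightarrow> (\<beta> has_vector_derivative \<beta>' x) (at x within I)"
    and "\<And>x. x \<in> I \<Longrightarrow> (\<beta>' has_vector_derivative \<beta>'' x) (at x within I)"
    and "\<And>x. x \<in> I \<Longrightarrow> \<beta> x ** jmat ** ctranspose (\<beta> x) = 0"
    and "\<And>x. x \<in> I \<Longrightarrow> \<beta>' x ** jmat ** ctranspose (\<beta> x) = mat \<i>"
    and "fundamental_solution I (Hamiltonian \<beta>) W"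
    and "0 < l" and "l \<in> I" and "l \<le> T"
    and "similarity_op T \<beta> V"
    and "z \<noteq> 0"
  shows "W l z = w_A T V \<beta> l (1 / z)"
proof -
  note l = \<open>0 < l\<close> \<open>l \<le> T\<close>
  have TI: "{0..T} \<subseteq> I" using assms(2) by auto
  have "continuous_on I \<beta>"
    using assms(3) has_vector_derivative_continuous continuous_on_eq_continuous_within by blast
  then have \<beta>: "continuous_on {0..T} \<beta>" by (rule continuous_on_subset[OF _ TI])
  have W0: "W 0 z = mat 1"
    and W: "\<And>x t. x \<le> T \<Longrightarrow> t \<in> {0..x} \<Longrightarrow>
      ((\<lambda>x. W x z) has_vector_derivative mat (\<i> * z) ** jmat ** Hamiltonian \<beta> t ** W t z) (at t within {0..x})"
  proof -
    note fs = assms(7)[unfolded fundamental_solution_def, rule_format, of z]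
    show "W 0 z = mat 1" by (rule conjunct1[OF fs])
    fix x t :: real assume x: "x \<le> T" "t \<in> {0..x}"
    then have sub: "{0..x} \<subseteq> I" "t \<in> I" using TI by auto
    show "((\<lambda>x. W x z) has_vector_derivative mat (\<i> * z) ** jmat ** Hamiltonian \<beta> t ** W t z) (at t within {0..x})"
      by (rule has_vector_derivative_within_subset[OF bspec[OF conjunct2[OF fs] sub(2)] sub(1)])
  qed
  have int_eq: "W x z *v h - h = mat (\<i> * z) *v (jmat *v (\<integral>t. ctranspose (\<beta> t) *v (\<beta> t *v (W t z *v h)) \<partial>leb x))"
    if "0 \<le> x" "x \<le> T" for x h
    by (rule canonical_integral[OF continuous_on_subset[OF \<beta>] that(1) W0 W]) (use that in auto)
  have V: "L2_bounded_op T T V" "triangular_form T V"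
    and sim: "\<And>f. f \<in> L2 T \<Longrightarrow> L2_eq T (K_op \<beta> f) (V (A_op (L2_inv T V f)))"
    using assms(11) unfolding similarity_op_def by auto
  obtain C u k where tri: "triangular T C u k" and V_tri: "\<And>f. f \<in> L2 T \<Longrightarrow> L2_eq T (V f) (tri_op T u k f)"
    using triangular_form_kernel[OF \<open>0 < T\<close> V(2)] by metis
  interpret triangular T C u k by fact
  have "L2_bounded_inverse T V (L2_inv T V)" by (rule V_inv[OF V(1) V_tri \<open>0 < T\<close>])
  note Vi = L2_bounded_inverseD[OF this]
  have Vl_op: "L2_bounded_op l l (tri_op l u k)" by (rule tri_op_bounded[OF l])
  have Vl_V: "L2_eq l (tri_op l u k f) (V f)" if "f \<in> L2 T" for f
    by (rule L2_eq_trans[OF L2_eqI L2_eq_mono[OF L2_eq_sym[OF V_tri[OF that]] l(2)]])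
      (simp add: tri_op_restrict[OF l])

  \<comment> \<open>the columns of \<open>\<beta>\<close>; all operators are evaluated on one column at a time\<close>
  define b where "b m t = \<beta> t *v axis m 1" for m t
  have b: "b m \<in> L2 T" for m
    unfolding b_def[abs_def] by (rule continuous_on_L2[OF continuous_on_mv[OF \<beta> continuous_on_const]])
  define P where "P = P_op l \<circ> Pi_op T V \<beta>"
  have P_axis: "P (axis m 1) = P_op l (L2_inv T V (b m))" for m
    by (simp add: P_def Pi_op_def Pi_fun_def b_def[abs_def] mv_axis column_def)
  have PL2: "P (axis m 1) \<in> L2 l" for m
    unfolding P_axis by (rule P_op_L2[OF L2_restrict[OF Vi(4)[OF b] l(2)] order_refl])
  have P_lin: "P h x = (\<Sum>i\<in>UNIV. h $ i *s P (axis i 1) x)" for h x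
  proof (cases "x \<in> {0<..<l}")
    case True
    then show ?thesis by (simp add: P_def P_op_def Pi_op_def matrix_mult_sum[of _ h] mv_axis)
  next
    case False
    then have "P h' x = 0" for h' unfolding P_def P_op_def by auto
    then show ?thesis by simp
  qed
  \<comment> \<open>\<open>V\<^sub>l \<Pi>\<^sub>l = \<beta>\<close>\<close>
  have VP: "L2_eq l (tri_op l u k (P (axis m 1))) (b m)" for m
  proof -
    have Gb: "L2_inv T V (b m) \<in> L2 T" by (rule Vi(4)[OF b])
    have "L2_eq l (tri_op l u k (P (axis m 1))) (tri_op l u k (L2_inv T V (b m)))"
      by (rule L2_bounded_op_cong[OF Vl_op PL2 L2_restrict[OF Gb l(2)]]) (unfold P_axis, rule P_op_eq)
    also note Vl_V[OF Gb]
    also have "L2_eq l (V (L2_inv T V (b m))) (b m)" by (rule L2_eq_mono[OF Vi(3)[OF b] l(2)])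
    finally show ?thesis .
  qed

  define c where "c = 1 / z"
  have c: "c \<noteq> 0" using \<open>z \<noteq> 0\<close> by (simp add: c_def)
  define R where "R = L2_inv l (\<lambda>(f :: real \<Rightarrow> complex^'p) x. compress T l A_op f x - c *s f x)"
  have R: "L2_bounded_inverse l (\<lambda>f x. compress T l A_op f x - c *s f x) R"
    unfolding R_def by (rule L2_inv_spec[OF A_resolvent[OF l c]])
  obtain CK where CK: "volterra T CK (\<lambda>x. x) (K_kernel \<beta>)" using volterra_K[OF \<open>0 < T\<close> \<beta>] .
  note CKl = volterra_restrict[OF CK l]

  \<comment> \<open>the candidate for the resolvent of \<open>K\<close> at \<open>c = 1 / z\<close> applied to the columns of \<open>\<beta>\<close>\<close>
  define \<psi> where "\<psi> m x = (- z) *s (\<beta> x *v (W x z *v axis m 1))" for m x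
  have Wc: "continuous_on {0..T} (\<lambda>x. W x z)"
    using W[OF order_refl] has_vector_derivative_continuous continuous_on_eq_continuous_within by blast
  have \<beta>W: "continuous_on {0..T} (\<lambda>x. \<beta> x *v (W x z *v h))" for h
    by (rule continuous_on_mv[OF \<beta> continuous_on_mv[OF Wc continuous_on_const]])
  have \<psi>: "\<psi> m \<in> L2 T" for m
    unfolding \<psi>_def[abs_def] by (rule L2_scale[OF continuous_on_L2[OF \<beta>W]])
  have \<psi>_int: "(\<integral>t. ctranspose (\<beta> t) *v \<psi> m t \<partial>leb x)
      = (- z) *s (\<integral>t. ctranspose (\<beta> t) *v (\<beta> t *v (W t z *v axis m 1)) \<partial>leb x)"
    if "x \<le> T" for m x
    unfolding \<psi>_def vector_scalar_commute
    by (rule integral_bounded_linear[OF bounded_linear_vscale integrable_mv_continuous[OF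
        continuous_on_ctranspose[OF continuous_on_subset[OF \<beta>]] L2_restrict[OF continuous_on_L2[OF \<beta>W] that]]])
      (use that in auto)
  have \<psi>_int_eq: "mat \<i> *v (jmat *v (\<integral>t. ctranspose (\<beta> t) *v \<psi> m t \<partial>leb x)) = axis m 1 - W x z *v axis m 1"
    if x: "0 \<le> x" "x \<le> T" for m x
  proof -
    have "mat \<i> *v (jmat *v (\<integral>t. ctranspose (\<beta> t) *v \<psi> m t \<partial>leb x)) = - (W x z *v axis m 1 - axis m 1)"
      unfolding int_eq[OF x] \<psi>_int[OF x(2)]
      by (simp only: mat_mv vector_scalar_commute) (simp add: vec_eq_iff)
    then show ?thesis by simp
  qed
  \<comment> \<open>multiply the integrated canonical system by \<open>\<beta>\<close> from the left: \<open>(K - c) \<psi> = \<beta>\<close>\<close>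
  have \<psi>_eq: "int_op l (K_kernel \<beta>) (\<psi> m) x = c *s \<psi> m x + b m x" if x: "x \<in> {0<..<l}" for m x
  proof -
    have xT: "x \<in> {0<..<T}" using x l by simp
    have "int_op l (K_kernel \<beta>) (\<psi> m) x = K_op \<beta> (\<psi> m) x"
      by (simp only: int_op_restrict[OF CK x l(2), symmetric] K_op_eq[OF \<beta> \<psi> xT])
    also have "\<dots> = \<beta> x *v (mat \<i> *v (jmat *v (\<integral>t. ctranspose (\<beta> t) *v \<psi> m t \<partial>leb x)))"
      unfolding K_op_def by (simp add: matrix_vector_mul_assoc[symmetric] mat_mv vector_scalar_commute)
    also have "\<dots> = b m x - \<beta> x *v (W x z *v axis m 1)"
      using xT by (subst \<psi>_int_eq) (auto simp: b_def matrix_vector_mult_diff_distrib)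
    also have "\<dots> = c *s \<psi> m x + b m x"
      using \<open>z \<noteq> 0\<close> by (simp add: \<psi>_def c_def vector_smult_assoc)
    finally show ?thesis .
  qed

  \<comment> \<open>\<open>V\<^sub>l (A\<^sub>l - c)\<^sup>-\<^sup>1 \<Pi>\<^sub>l = (K\<^sub>l - c)\<^sup>-\<^sup>1 \<beta>\<close>, computed from \<open>V\<^sub>l A\<^sub>l = K\<^sub>l V\<^sub>l\<close>\<close>
  have resolvent: "L2_eq l (tri_op l u k (R (P (axis m 1)))) (\<psi> m)" for m
  proof -
    define f where "f = R (P (axis m 1))"
    have f: "f \<in> L2 l" unfolding f_def by (rule L2_bounded_inverseD(4)[OF R PL2])
    have Rf: "L2_eq l (\<lambda>x. compress T l A_op f x - c *s f x) (P (axis m 1))"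
      unfolding f_def by (rule L2_bounded_inverseD(3)[OF R PL2])
    have Af: "L2_eq l (A_op f) (\<lambda>x. c *s f x + 1 *s P (axis m 1) x)"
      using Rf unfolding L2_eq_def
      by (elim AE_mp) (rule AE_I2, simp add: compress_A[OF l(2) f] algebra_simps)
    define \<phi> where "\<phi> = tri_op l u k f"
    have \<phi>: "\<phi> \<in> L2 l" unfolding \<phi>_def by (rule L2_bounded_op_L2[OF Vl_op f])
    \<comment> \<open>the similarity relation lives on \<open>(0,T)\<close>; apply it to an extension of \<open>f\<close> and restrict\<close>
    define e where "e = P_op l f"
    have e: "e \<in> L2 T" unfolding e_def by (rule P_op_L2[OF f l(2)])
    have el: "L2_eq l e f" unfolding e_def by (rule P_op_eq)
    have Ve: "V e \<in> L2 T" by (rule L2_bounded_op_L2[OF V(1) e])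
    have Ae: "A_op e \<in> L2 T" by (rule A_op_L2[OF \<open>0 < T\<close> e])
    have GVe: "L2_inv T V (V e) \<in> L2 T" by (rule Vi(4)[OF Ve])
    have Ve_\<phi>: "L2_eq l (V e) \<phi>" unfolding \<phi>_def
      by (rule L2_eq_trans[OF L2_eq_sym[OF Vl_V[OF e]] L2_bounded_op_cong[OF Vl_op L2_restrict[OF e l(2)] f el]])
    have "L2_eq l (int_op l (K_kernel \<beta>) \<phi>) (K_op \<beta> (V e))"
    proof (rule L2_eqI)
      fix x assume x: "0 < x" "x < l"
      then have xl: "x \<in> {0<..<l}" and xT: "x \<in> {0<..<T}" using l by auto
      show "int_op l (K_kernel \<beta>) \<phi> x = K_op \<beta> (V e) x"
        by (simp only: K_op_eq[OF \<beta> Ve xT] int_op_restrict[OF CK xl l(2)] int_op_cong[OF Ve_\<phi>])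
    qed
    also have "L2_eq l (K_op \<beta> (V e)) (V (A_op (L2_inv T V (V e))))" by (rule L2_eq_mono[OF sim[OF Ve] l(2)])
    also have "L2_eq l (V (A_op (L2_inv T V (V e)))) (V (A_op e))"
      by (rule L2_eq_mono[OF L2_bounded_op_cong[OF V(1) A_op_L2[OF \<open>0 < T\<close> GVe] Ae A_op_cong[OF Vi(2)[OF e]]] l(2)])
    also have "L2_eq l (V (A_op e)) (tri_op l u k (A_op e))" by (rule L2_eq_sym[OF Vl_V[OF Ae]])
    also have "L2_eq l (tri_op l u k (A_op e)) (tri_op l u k (\<lambda>x. c *s f x + 1 *s P (axis m 1) x))"
      by (rule L2_bounded_op_cong[OF Vl_op L2_restrict[OF Ae l(2)] L2_lin[OF f PL2] L2_eq_trans[OF A_op_cong[OF el] Af]])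
    also have "L2_eq l \<dots> (\<lambda>x. c *s \<phi> x + 1 *s tri_op l u k (P (axis m 1)) x)"
      unfolding \<phi>_def by (rule L2_bounded_op_lin[OF Vl_op f PL2])
    also have "L2_eq l \<dots> (\<lambda>x. c *s \<phi> x + 1 *s b m x)" by (rule L2_eq_lin[OF L2_eq_refl VP])
    finally have \<phi>_eq: "L2_eq l (int_op l (K_kernel \<beta>) \<phi>) (\<lambda>x. c *s \<phi> x + 1 *s b m x)" .
    \<comment> \<open>\<open>\<phi>\<close> and \<open>\<psi>\<close> solve the same Volterra equation, whose solution is unique\<close>
    obtain G where G: "L2_bounded_inverse l (\<lambda>f x. f x + (- z) *s int_op l (K_kernel \<beta>) f x) G"
      using volterra_scaled_invertible(2)[OF CKl] by blast
    note bop = volterra_scaled_invertible(1)[OF CKl, of "- z"]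
    have \<psi>l: "\<psi> m \<in> L2 l" by (rule L2_restrict[OF \<psi> l(2)])
    have "L2_eq l \<phi> (\<psi> m)"
    proof (rule L2_bounded_inverse_inj[OF G \<phi> \<psi>l L2_bounded_op_L2[OF bop \<phi>] L2_bounded_op_L2[OF bop \<psi>l]])
      have step: "y + (- z) *s (c *s y + 1 *s w) = (- z) *s w" for y w :: "complex^'p"
        using \<open>z \<noteq> 0\<close> by (simp add: vec_eq_iff c_def algebra_simps)
      have "L2_eq l (\<lambda>x. \<phi> x + (- z) *s int_op l (K_kernel \<beta>) \<phi> x) (\<lambda>x. (- z) *s b m x)"
        using \<phi>_eq unfolding L2_eq_def by eventually_elim (simp only: step)
      also have "L2_eq l (\<lambda>x. (- z) *s b m x) (\<lambda>x. \<psi> m x + (- z) *s int_op l (K_kernel \<beta>) (\<psi> m) x)"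
        by (rule L2_eqI) (use \<psi>_eq step[of "\<psi> m _" "b m _"] in simp)
      finally show "L2_eq l (\<lambda>x. \<phi> x + (- z) *s int_op l (K_kernel \<beta>) \<phi> x)
        (\<lambda>x. \<psi> m x + (- z) *s int_op l (K_kernel \<beta>) (\<psi> m) x)" .
    qed
    then show ?thesis by (simp add: \<phi>_def f_def)
  qed

  \<comment> \<open>\<open>\<Pi>\<^sub>l\<^sup>* V\<^sub>l\<^sup>*\<close> is the adjoint of \<open>V\<^sub>l \<Pi>\<^sub>l = \<beta>\<close>, so the last step is pairing \<open>\<psi>\<close> with the columns of \<open>\<beta>\<close>\<close>
  define S where "S = L2_inv l (compress T l (S_op T V))"
  have entry: "vec_L2_adj l P (S (R (P (axis m 1)))) = (\<integral>t. ctranspose (\<beta> t) *v \<psi> m t \<partial>leb l)" for m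
  proof (rule vec_eq_iff[THEN iffD2], rule allI)
    fix i
    define f where "f = R (P (axis m 1))"
    have f: "f \<in> L2 l" unfolding f_def by (rule L2_bounded_inverseD(4)[OF R PL2])
    have Sf: "S f \<in> L2 l" "L2_eq l (S f) (tri_adj l u k (tri_op l u k f))"
      unfolding S_def by (rule Sl_inv_eq[OF V(1) V_tri \<open>0 < T\<close> l f]; assumption)+
    have Vf: "tri_op l u k f \<in> L2 l" by (rule L2_bounded_op_L2[OF Vl_op f])
    have cnj: "L2_inner l h g = cnj (L2_inner l g h)" for g h :: "real \<Rightarrow> complex^'p"
      unfolding L2_inner_def by (subst cinner_commute) simp
    have int: "integrable (leb l) (\<lambda>t. ctranspose (\<beta> t) *v \<psi> m t)"
      by (rule integrable_mv_continuous[OF continuous_on_ctranspose[OF continuous_on_subset[OF \<beta>]] L2_restrict[OF \<psi> l(2)]])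
        (use l in auto)
    have "vec_L2_adj l P (S f) $ i = L2_inner l (S f) (P (axis i 1))"
      by (rule vec_L2_adj_nth[OF PL2 P_lin Sf(1)])
    also have "\<dots> = L2_inner l (tri_adj l u k (tri_op l u k f)) (P (axis i 1))"
      by (rule L2_inner_cong[OF Sf(2) L2_eq_refl])
    also have "\<dots> = L2_inner l (tri_op l u k f) (tri_op l u k (P (axis i 1)))"
      by (subst (1 2) cnj) (simp add: tri_adjoint[OF l PL2 Vf])
    also have "\<dots> = L2_inner l (\<psi> m) (b i)"
      by (rule L2_inner_cong[OF resolvent[of m, folded f_def] VP])
    also have "\<dots> = (\<integral>t. (ctranspose (\<beta> t) *v \<psi> m t) $ i \<partial>leb l)"
      unfolding L2_inner_def
    proof (rule integral_leb_cong, rule AE_I2)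
      fix t
      have "cinner (b i t) (\<psi> m t) = cnj ((ctranspose (\<beta> t) *v \<psi> m t) $ i)"
        unfolding b_def cinner_mv cinner_axis ..
      then show "cinner (\<psi> m t) (b i t) = (ctranspose (\<beta> t) *v \<psi> m t) $ i"
        by (subst cinner_commute) simp
    qed
    also have "\<dots> = (\<integral>t. ctranspose (\<beta> t) *v \<psi> m t \<partial>leb l) $ i"
      by (rule integral_bounded_linear[OF bounded_linear_vec_nth int])
    finally show "vec_L2_adj l P (S (R (P (axis m 1)))) $ i = (\<integral>t. ctranspose (\<beta> t) *v \<psi> m t \<partial>leb l) $ i"
      by (simp only: f_def)
  qed
  show ?thesis
  proof (rule matrix_eqI_axis)
    fix m
    have "w_A T V \<beta> l (1 / z) = mat 1 - mat \<i> ** jmat ** matrix (vec_L2_adj l P \<circ> S \<circ> R \<circ> P)"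
      by (simp add: w_A_def Let_def P_def S_def R_def c_def)
    then have "w_A T V \<beta> l (1 / z) *v axis m 1
      = axis m 1 - mat \<i> *v (jmat *v (vec_L2_adj l P (S (R (P (axis m 1))))))"
      by (simp add: matrix_vector_mult_diff_rdistrib matrix_vector_mul_assoc[symmetric] matrix_mv_axis)
    also have "\<dots> = W l z *v axis m 1"
      unfolding entry using \<psi>_int_eq[of l m] l by simp
    finally show "W l z *v axis m 1 = w_A T V \<beta> l (1 / z) *v axis m 1" by simp
  qed
qed

end
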